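(* Let $H$ be a complex Hilbert space, let $L$ be a locally compact Hausdorff space whose topology is denoted by $\tau$, and let $D$ be a $^*$-derivation on $C_0(L,K(H))$. Then there exists a (bounded) mapping $Z_0:L\to B(H)$ which is $\tau$-to-$\sigma(B(H),B(H)_* )$ continuous, with $\|Z_0\|\leq\|D\|$, $Z_0(t)^*=-Z_0(t)$ for every $t\in L$, and $D(X)=[Z_0,X]$ for every $X\in C_0(L,K(H))$. If $D$ is a general derivation on $C_0(L,K(H))$, then there exists a bounded function $Z_0:L\to B(H)$ which is $\tau$-to-$\sigma(B(H),B(H)_* )$ continuous, with $\|Z_0\|\leq2\|D\|$ and $D(X)=[Z_0,X]$ for every $X\in C_0(L,K(H))$.
   Context: $B(H)$ is the algebra of bounded operators on $H$, $K(H)$ the C$^*$-algebra of compact operators, and $\sigma(B(H),B(H)_* )$ the weak$^*$ (ultraweak) topology of $B(H)$. $C_0(L,K(H))$ is the C$^*$-algebra of all norm-continuous functions $L\to K(H)$ vanishing at infinity, with pointwise operations and the supremum norm. $\|Z_0\|=\sup_{t\in L}\|Z_0(t)\|$ and $[Z_0,X](t)=Z_0(t)X(t)-X(t)Z_0(t)$. A derivation on a C$^*$-algebra $B$ is a linear map $D:B\to B$ with $D(ab)=D(a)b+aD(b)$ for all $a,b\in B$ (automatically bounded); it is a $^*$-derivation if moreover $D(a^* )=D(a)^*$ for all $a$. *)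

theory Defs
  imports "HOL-Analysis.Analysis"
begin

(* A complex inner product space, presented as a real_inner space carrying a compatible
   complex structure.  The form is linear in the first argument.  Positive definiteness and
   norm x = sqrt (Re (cinner x x)) are inherited from real_inner through Re_cinner. *)
class complex_inner = real_inner +
  fixes scaleC :: "complex \<Rightarrow> 'a \<Rightarrow> 'a"  (infixr "*\<^sub>C" 75)
    and cinner :: "'a \<Rightarrow> 'a \<Rightarrow> complex"
  assumes scaleC_add_right: "c *\<^sub>C (x + y) = c *\<^sub>C x + c *\<^sub>C y"
    and scaleC_add_left: "(c + d) *\<^sub>C x = c *\<^sub>C x + d *\<^sub>C x"
    and scaleC_scaleC: "c *\<^sub>C (d *\<^sub>C x) = (c * d) *\<^sub>C x"
    and scaleC_of_real: "complex_of_real r *\<^sub>C x = scaleR r x"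
    and cinner_commute: "cinner x y = cnj (cinner y x)"
    and cinner_add_left: "cinner (x + y) z = cinner x z + cinner y z"
    and cinner_scaleC_left: "cinner (c *\<^sub>C x) y = c * cinner x y"
    and Re_cinner: "Re (cinner x y) = inner x y"

class complex_hilbert = complex_inner + complete_space

lemma norm_scaleC: "norm (c *\<^sub>C x) = cmod c * norm (x :: 'a::complex_inner)"
proof -
  have *: "cinner z z = complex_of_real ((norm z)\<^sup>2)" for z :: 'a
  proof -
    have "Im (cinner z z) = 0"
      using arg_cong[OF cinner_commute[of z z], of Im] by simp
    then show ?thesis
      by (simp add: complex_eq_iff Re_cinner power2_norm_eq_inner)
  qed
  have "cinner (c *\<^sub>C x) (c *\<^sub>C x) = c * cnj (c * cinner x x)"
    by (metis cinner_commute cinner_scaleC_left)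
  also have "\<dots> = (c * cnj c) * complex_of_real ((norm x)\<^sup>2)"
    by (simp add: *)
  also have "\<dots> = complex_of_real ((cmod c * norm x)\<^sup>2)"
    by (simp only: complex_norm_square[symmetric] power_mult_distrib of_real_mult of_real_power)
  finally have "(norm (c *\<^sub>C x))\<^sup>2 = (cmod c * norm x)\<^sup>2"
    unfolding * of_real_eq_iff .
  then show ?thesis by (simp add: power2_eq_iff_nonneg)
qed

lemma bounded_linear_scaleC: "bounded_linear (\<lambda>x :: 'a::complex_inner. c *\<^sub>C x)"
proof (rule bounded_linear_intro[where K = "cmod c"])
  fix r and x :: 'a
  show "c *\<^sub>C (r *\<^sub>R x) = r *\<^sub>R (c *\<^sub>C x)"
    by (metis scaleC_of_real scaleC_scaleC mult.commute)
qed (simp_all add: scaleC_add_right norm_scaleC mult.commute)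

(* The type of blinfuns consists of the bounded real-linear maps, so B(H) is the subset
   of complex-linear ones; the operator norm is the norm of that type. *)
definition bounded_ops :: "('h::complex_hilbert \<Rightarrow>\<^sub>L 'h) set" where
  "bounded_ops = {T. \<forall>c x. blinfun_apply T (c *\<^sub>C x) = c *\<^sub>C blinfun_apply T x}"

definition compact_ops :: "('h::complex_hilbert \<Rightarrow>\<^sub>L 'h) set" where
  "compact_ops = {T \<in> bounded_ops. compact (closure (blinfun_apply T ` cball 0 1))}"

lift_definition op_scaleC :: "complex \<Rightarrow> ('h::complex_hilbert \<Rightarrow>\<^sub>L 'h) \<Rightarrow> ('h \<Rightarrow>\<^sub>L 'h)"
  is "\<lambda>c T x. c *\<^sub>C T x"
  by (rule bounded_linear_compose[OF bounded_linear_scaleC])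

definition op_adj :: "('h::complex_hilbert \<Rightarrow>\<^sub>L 'h) \<Rightarrow> ('h \<Rightarrow>\<^sub>L 'h)" where
  "op_adj T = (THE S. S \<in> bounded_ops \<and>
     (\<forall>x y. cinner (blinfun_apply T x) y = cinner x (blinfun_apply S y)))"

(* The predual of B(H): the functionals T |-> sum_n <T x_n, y_n> with square-summable
   (norm x_n), (norm y_n), i.e. T |-> trace (R T) with R of trace class. *)
definition predual :: "(('h::complex_hilbert \<Rightarrow>\<^sub>L 'h) \<Rightarrow> complex) set" where
  "predual = {\<phi>. \<exists>x y :: nat \<Rightarrow> 'h.
     summable (\<lambda>n. (norm (x n))\<^sup>2) \<and> summable (\<lambda>n. (norm (y n))\<^sup>2) \<and>
     \<phi> = (\<lambda>T. \<Sum>n. cinner (blinfun_apply T (x n)) (y n))}"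

(* The weak-star topology of B(H) against its predual: the coarsest topology on B(H) making every element of the predual
   continuous; its topspace is bounded_ops. *)
definition ultraweak :: "('h::complex_hilbert \<Rightarrow>\<^sub>L 'h) topology" where
  "ultraweak = topology_generated_by
     {{T \<in> bounded_ops. \<phi> T \<in> U} | \<phi> U. \<phi> \<in> predual \<and> open U}"

lemma topspace_ultraweak: "topspace ultraweak = (bounded_ops :: ('h::complex_hilbert \<Rightarrow>\<^sub>L 'h) set)"
proof -
  have z: "(\<lambda>T. \<Sum>n. cinner (blinfun_apply T (0::'h)) 0) \<in> predual"
    unfolding predual_def by (rule CollectI, rule exI[of _ "\<lambda>_. 0"], rule exI[of _ "\<lambda>_. 0"]) simp
  have "bounded_ops \<in> {{T \<in> bounded_ops. \<phi> T \<in> U} | \<phi> U. \<phi> \<in> (predual :: (('h \<Rightarrow>\<^sub>L 'h) \<Rightarrow> complex) set) \<and> open U}"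
    using z by (intro CollectI exI[of _ UNIV] exI conjI) auto
  then show ?thesis
    unfolding ultraweak_def topology_generated_by_topspace by auto
qed

(* C_0(L,K(H)) for the space L with topology \<tau>.  The underlying set of L is topspace \<tau>;
   its members are extended by 0 to the ambient type, so that a function on L has exactly
   one representative. *)
definition C0 :: "'l topology \<Rightarrow> ('l \<Rightarrow> ('h::complex_hilbert \<Rightarrow>\<^sub>L 'h)) set" where
  "C0 \<tau> = {X. continuous_map \<tau> euclidean X \<and>
              (\<forall>t \<in> topspace \<tau>. X t \<in> compact_ops) \<and>
              (\<forall>e > 0. \<exists>K. compactin \<tau> K \<and> (\<forall>t \<in> topspace \<tau> - K. norm (X t) < e)) \<and>
              (\<forall>t. t \<notin> topspace \<tau> \<longrightarrow> X t = 0)}"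

(* Taken in [0,\<infinity>], so that the norm is 0 on the empty space and infinite
   for unbounded functions. *)
definition sup_norm :: "'l topology \<Rightarrow> ('l \<Rightarrow> ('h::complex_hilbert \<Rightarrow>\<^sub>L 'h)) \<Rightarrow> ennreal" where
  "sup_norm \<tau> X = (SUP t \<in> topspace \<tau>. ennreal (norm (X t)))"

definition map_norm ::
  "'l topology \<Rightarrow> (('l \<Rightarrow> ('h::complex_hilbert \<Rightarrow>\<^sub>L 'h)) \<Rightarrow> ('l \<Rightarrow> ('h \<Rightarrow>\<^sub>L 'h))) \<Rightarrow> ennreal" where
  "map_norm \<tau> D = (SUP X \<in> {X \<in> C0 \<tau>. sup_norm \<tau> X \<le> 1}. sup_norm \<tau> (D X))"

(* Boundedness of D is not part of the definition. *)
definition derivation ::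
  "'l topology \<Rightarrow> (('l \<Rightarrow> ('h::complex_hilbert \<Rightarrow>\<^sub>L 'h)) \<Rightarrow> ('l \<Rightarrow> ('h \<Rightarrow>\<^sub>L 'h))) \<Rightarrow> bool" where
  "derivation \<tau> D \<longleftrightarrow>
     (\<forall>X \<in> C0 \<tau>. D X \<in> C0 \<tau>) \<and>
     (\<forall>X \<in> C0 \<tau>. \<forall>Y \<in> C0 \<tau>. D (\<lambda>t. X t + Y t) = (\<lambda>t. D X t + D Y t)) \<and>
     (\<forall>c. \<forall>X \<in> C0 \<tau>. D (\<lambda>t. op_scaleC c (X t)) = (\<lambda>t. op_scaleC c (D X t))) \<and>
     (\<forall>X \<in> C0 \<tau>. \<forall>Y \<in> C0 \<tau>.
        D (\<lambda>t. X t o\<^sub>L Y t) = (\<lambda>t. (D X t o\<^sub>L Y t) + (X t o\<^sub>L D Y t)))"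

definition star_derivation ::
  "'l topology \<Rightarrow> (('l \<Rightarrow> ('h::complex_hilbert \<Rightarrow>\<^sub>L 'h)) \<Rightarrow> ('l \<Rightarrow> ('h \<Rightarrow>\<^sub>L 'h))) \<Rightarrow> bool" where
  "star_derivation \<tau> D \<longleftrightarrow> derivation \<tau> D \<and>
     (\<forall>X \<in> C0 \<tau>. D (\<lambda>t. op_adj (X t)) = (\<lambda>t. op_adj (D X t)))"

definition commutator ::
  "('l \<Rightarrow> ('h::complex_hilbert \<Rightarrow>\<^sub>L 'h)) \<Rightarrow> ('l \<Rightarrow> ('h \<Rightarrow>\<^sub>L 'h)) \<Rightarrow> ('l \<Rightarrow> ('h \<Rightarrow>\<^sub>L 'h))" where
  "commutator Z X = (\<lambda>t. (Z t o\<^sub>L X t) - (X t o\<^sub>L Z t))"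

end

theory Submission
  imports Defs
begin

text \<open>If \<open>X\<close> vanishes at \<open>t\<close> then so does \<open>D X\<close>, so \<open>D\<close> splits into derivations \<open>D\<^sub>t\<close> of the
  compact operators.  Writing \<open>\<theta>(x, y)\<close> for the operator \<open>z \<mapsto> \<langle>z, y\<rangle> x\<close> and fixing a unit vector \<open>\<xi>\<close>, the operator
  \<open>Z(t) x = D\<^sub>t(\<theta>(x, \<xi>)) \<xi>\<close> implements \<open>D\<^sub>t\<close>: apply \<open>D\<^sub>t\<close> to \<open>a \<theta>(x, \<xi>) = \<theta>(a x, \<xi>)\<close> and evaluate
  at \<open>\<xi>\<close>.  Since \<open>\<theta>(x, \<xi>)\<close> has norm \<open>\<parallel>x\<parallel>\<close>, this gives \<open>\<parallel>Z\<parallel> \<le> \<parallel>D\<parallel>\<close> and norm continuity of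
  \<open>t \<mapsto> Z(t) x\<close>, even for general derivations.  As \<open>\<theta>(\<xi>, \<xi>)\<close> is a projection,
  \<open>\<langle>Z(t) \<xi>, \<xi>\<rangle> = 0\<close>; this normalisation makes \<open>Z(t)\<close> skew-adjoint when \<open>D\<close> is a \<open>*\<close>-derivation.
  Boundedness of \<open>D\<close> is not presupposed: it comes from a gliding hump in \<open>\<tau>\<close> followed by the uniform
  boundedness principle in the Hilbert space.\<close>

subsection \<open>Operators on a complex Hilbert space\<close>

lemma cinner_zero_left [simp]: "cinner 0 y = 0"
  using cinner_add_left[of 0 0 y] by simp

lemma cinner_zero_right [simp]: "cinner x 0 = 0"
  by (metis cinner_commute cinner_zero_left complex_cnj_zero)

lemma cinner_add_right: "cinner x (y + z) = cinner x y + cinner x z"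
  by (metis cinner_add_left cinner_commute complex_cnj_add)

lemma cinner_scaleC_right: "cinner x (c *\<^sub>C y) = cnj c * cinner x y"
  by (metis cinner_commute cinner_scaleC_left complex_cnj_mult)

lemma cinner_minus_right: "cinner x (- y) = - cinner x y"
  using cinner_add_right[of x y "- y"] by (simp add: eq_neg_iff_add_eq_0 add.commute)

lemma cinner_diff_right: "cinner x (y - z) = cinner x y - cinner x z"
  by (metis cinner_add_right cinner_minus_right diff_conv_add_uminus)

lemma cinner_scaleR_left: "cinner (r *\<^sub>R x) y = r *\<^sub>R cinner x y"
  by (metis cinner_scaleC_left scaleC_of_real scaleR_conv_of_real)

lemma cinner_self: "cinner x x = complex_of_real ((norm x)\<^sup>2)"
proof -
  have "Im (cinner x x) = 0"
    using arg_cong[OF cinner_commute[of x x], of Im] by simp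
  then show ?thesis
    by (simp add: complex_eq_iff Re_cinner power2_norm_eq_inner)
qed

lemma cmod_cinner_le: "cmod (cinner x y) \<le> norm x * norm y"
proof (cases "cinner x y = 0")
  case False
  \<comment> \<open>The phase \<open>c\<close> rotates \<open>cinner x y\<close> onto its modulus,
    so the real Cauchy-Schwarz inequality for \<open>c *\<^sub>C x\<close> and \<open>y\<close>
    yields the complex one.\<close>
  define c where "c = cnj (sgn (cinner x y))"
  have c: "cmod c = 1"
    using False by (simp add: c_def norm_sgn)
  have "c * cinner x y = complex_of_real (cmod (cinner x y))"
    using False
    by (simp add: c_def sgn_div_norm scaleR_conv_of_real field_simps
        complex_norm_square[symmetric] power2_eq_square)
  then have "cmod (cinner x y) = inner (c *\<^sub>C x) y"
    by (metis Re_cinner Re_complex_of_real cinner_scaleC_left)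
  also have "\<dots> \<le> norm (c *\<^sub>C x) * norm y"
    by (rule norm_cauchy_schwarz)
  finally show ?thesis
    by (simp add: norm_scaleC c)
qed simp

lemma bounded_linear_cinner_left: "bounded_linear (\<lambda>x. cinner x y)"
  by (rule bounded_linear_intro[where K = "norm y"])
    (simp_all add: cinner_add_left cinner_scaleR_left cmod_cinner_le)

lemma cinner_eqI: "(\<And>w. cinner x w = cinner y w) \<Longrightarrow> x = y"
  by (metis Re_cinner inner_eq_zero_iff inner_diff_left right_minus_eq)

lemma scaleC_one [simp]: "1 *\<^sub>C x = x"
  by (metis of_real_1 scaleC_of_real scaleR_one)

lemma scaleC_scaleR: "c *\<^sub>C (r *\<^sub>R x) = r *\<^sub>R (c *\<^sub>C x)"
  by (metis scaleC_of_real scaleC_scaleC mult.commute)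

lemma scaleC_minus_right: "c *\<^sub>C (- x) = - (c *\<^sub>C x)"
  by (rule linear_neg[OF bounded_linear.linear[OF bounded_linear_scaleC]])

lemma scaleC_scaleR_left: "(r *\<^sub>R c) *\<^sub>C x = r *\<^sub>R (c *\<^sub>C x)"
  by (metis scaleC_of_real scaleC_scaleC scaleR_conv_of_real)

lemma bounded_linear_scaleC_left: "bounded_linear (\<lambda>c. c *\<^sub>C x)"
  by (rule bounded_linear_intro[where K = "norm x"])
    (simp_all add: scaleC_add_left norm_scaleC scaleR_conv_of_real
      flip: scaleC_of_real scaleC_scaleC)

section \<open>Uniform boundedness, Riesz representation and adjoints\<close>

text \<open>Uniform boundedness by Baire category: the closed sets \<open>C n\<close> exhaust the
  space, so one of them contains a ball, and a uniform bound on a ball gives a norm bound on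
  \<open>W\<close>.\<close>

lemma weakly_bounded_imp_bounded:
  fixes W :: "'a::{real_inner,complete_space} set"
  assumes "\<And>v. bounded ((\<lambda>w. inner w v) ` W)"
  shows "bounded W"
proof -
  define C where "C n = {v. \<forall>w\<in>W. \<bar>inner w v\<bar> \<le> real n}" for n :: nat
  have cl: "closed (C n)" for n
  proof -
    have "C n = (\<Inter>w\<in>W. {v. \<bar>inner w v\<bar> \<le> real n})"
      by (auto simp: C_def)
    then show ?thesis
      by (auto intro!: closed_INT closed_Collect_le continuous_intros)
  qed
  have un: "(\<Union>n. C n) = UNIV"
  proof -
    have "\<exists>n. v \<in> C n" for v
    proof -
      obtain B where "\<forall>w\<in>W. \<bar>inner w v\<bar> \<le> B"
        using assms[of v] by (auto simp: bounded_iff)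
      moreover obtain n where "B \<le> real n"
        using real_arch_simple by blast
      ultimately show ?thesis
        unfolding C_def by (intro exI[of _ n]) force
    qed
    then show ?thesis by blast
  qed
  have "\<exists>n. interior (C n) \<noteq> {}"
  proof (rule ccontr)
    assume "\<not> ?thesis"
    then have "euclidean interior_of (\<Union>(range C)) = {}"
      using cl by (intro Met_TC.metric_Baire_category_alt[unfolded mtopology_is_euclidean])
        (auto simp: complete_UNIV)
    then show False
      using un by simp
  qed
  then obtain n x where "x \<in> interior (C n)"
    by blast
  then obtain r where r: "r > 0" "cball x r \<subseteq> C n"
    by (auto simp: mem_interior_cball)
  have "norm w \<le> 2 * real n / r" if "w \<in> W" for w
  proof (cases "w = 0")
    case False
    \<comment> \<open>The vector \<open>u\<close> has length \<open>r\<close> and points along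
      \<open>w\<close>, so \<open>x + u\<close> stays in the ball; subtracting the two bounds at
      \<open>x + u\<close> and \<open>x\<close> controls
      \<open>inner w u = r * norm w\<close>.\<close>
    define u where "u = (r / norm w) *\<^sub>R w"
    have "norm u = r"
      using False r by (simp add: u_def)
    then have "x + u \<in> C n" "x \<in> C n"
      using r by (auto simp: subset_iff dist_norm)
    then have "\<bar>inner w (x + u)\<bar> \<le> real n" "\<bar>inner w x\<bar> \<le> real n"
      using that by (auto simp: C_def)
    then have "inner w u \<le> 2 * real n"
      by (simp add: inner_add_right)
    moreover have "inner w u = r * norm w"
      using False by (simp add: u_def dot_square_norm power2_eq_square)
    ultimately show ?thesis
      using r by (simp add: field_simps)
  qed (use r in auto)
  then show ?thesis
    by (auto simp: bounded_iff)
qed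

text \<open>The representing vector is the minimiser of the quadratic functional \<open>q\<close>. A
  minimising sequence is Cauchy by the parallelogram law, and the limit satisfies the first-order
  condition, which is the claim.\<close>

lemma Riesz_representation_real:
  fixes f :: "'a::{real_inner,complete_space} \<Rightarrow> real"
  assumes "bounded_linear f"
  shows "\<exists>w. \<forall>x. f x = inner x w"
proof -
  interpret f: bounded_linear f by fact
  obtain K where K: "\<And>x. \<bar>f x\<bar> \<le> norm x * K" "K > 0"
    using f.pos_bounded by auto
  define q where "q x = (norm x)\<^sup>2 / 2 - f x" for x
  have lb: "- (K\<^sup>2 / 2) \<le> q x" for x
  proof -
    have "0 \<le> (norm x - K)\<^sup>2" by simp
    then show ?thesis
      using K(1)[of x] unfolding q_def power2_diff by simp
  qed
  then have bdd: "bdd_below (range q)"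
    by (auto simp: bdd_below_def)
  define m where "m = (INF x. q x)"
  have m: "m \<le> q x" for x
    unfolding m_def by (rule cINF_lower[OF bdd]) simp
  have "\<exists>x. q x < m + e" if "e > 0" for e
    using cINF_less_iff[OF _ bdd, of "m + e"] that by (auto simp: m_def)
  then have "\<forall>n. \<exists>x. q x < m + 1 / real (Suc n)"
    by simp
  then obtain X where X: "\<And>n. q (X n) < m + 1 / real (Suc n)"
    by metis
  \<comment> \<open>The parallelogram law for \<open>q\<close>. Since \<open>q\<close> at the
    midpoint is at least \<open>m\<close>, two near-minimisers must be close to each other.\<close>
  have mid: "q ((1/2) *\<^sub>R (x + y)) = q x / 2 + q y / 2 - (norm (x - y))\<^sup>2 / 8" for x y
    unfolding q_def f.add f.scaleR
    by (simp add: power2_norm_eq_inner inner_add inner_diff inner_commute field_simps)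
  have dist: "(dist (X i) (X j))\<^sup>2 \<le> 4 / real (Suc i) + 4 / real (Suc j)" for i j
    using m[of "(1/2) *\<^sub>R (X i + X j)"] X[of i] X[of j] mid[of "X i" "X j"]
    by (simp add: dist_norm)
  have "Cauchy X"
  proof (rule metric_CauchyI)
    fix e :: real assume "e > 0"
    then obtain N where N: "8 / e\<^sup>2 < real N"
      using reals_Archimedean2 by blast
    have "dist (X i) (X j) < e" if "i \<ge> N" "j \<ge> N" for i j
    proof -
      have "N > 0" using N \<open>e > 0\<close>
        by (metis divide_nonneg_nonneg gr0I not_less of_nat_0 zero_le_numeral zero_le_power2)
      have "4 / real (Suc k) \<le> 4 / real N" if "k \<ge> N" for k
        using that \<open>N > 0\<close> by (intro divide_left_mono) auto
      then have "(dist (X i) (X j))\<^sup>2 \<le> 4 / real N + 4 / real N"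
        using dist[of i j] that by (smt (verit))
      also have "\<dots> < e\<^sup>2"
        using N \<open>N > 0\<close> \<open>e > 0\<close> by (simp add: field_simps)
      finally show ?thesis
        using \<open>e > 0\<close> by (simp add: power2_less_imp_less)
    qed
    then show "\<exists>M. \<forall>i\<ge>M. \<forall>j\<ge>M. dist (X i) (X j) < e"
      by blast
  qed
  then obtain w where w: "X \<longlonglongrightarrow> w"
    using Cauchy_convergent_iff convergent_def by blast
  have "(\<lambda>n. q (X n)) \<longlonglongrightarrow> q w"
    unfolding q_def by (intro tendsto_intros f.tendsto w) simp
  moreover have "(\<lambda>n. q (X n)) \<longlonglongrightarrow> m"
  proof (rule tendsto_sandwich[OF _ _ tendsto_const])
    show "(\<lambda>n. m + 1 / real (Suc n)) \<longlonglongrightarrow> m"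
      using tendsto_add[OF tendsto_const LIMSEQ_inverse_real_of_nat, of m]
      by (simp add: inverse_eq_divide)
  qed (use m X[THEN less_imp_le] in auto)
  ultimately have qw: "q w = m"
    using LIMSEQ_unique by blast
  have "f x = inner x w" for x
  proof -
    have *: "0 \<le> s * (inner x w - f x) + s\<^sup>2 * ((norm x)\<^sup>2 / 2)" for s
    proof -
      have "q (w + s *\<^sub>R x) = q w + s * (inner x w - f x) + s\<^sup>2 * ((norm x)\<^sup>2 / 2)"
        unfolding q_def f.add f.scaleR power2_norm_eq_inner
        by (simp add: inner_add inner_commute algebra_simps power2_eq_square)
      then show ?thesis
        using m[of "w + s *\<^sub>R x"] qw by simp
    qed
    define d where "d = inner x w - f x"
    define a where "a = (norm x)\<^sup>2 / 2"
    have a: "a \<ge> 0" by (simp add: a_def)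
    \<comment> \<open>This step makes \<open>s * d + s\<^sup>2 * a\<close> collapse to
      \<open>- s\<^sup>2\<close>, so minimality forces \<open>s = 0\<close>; the summand 1 keeps the
      denominator positive even for \<open>x = 0\<close>.\<close>
    define s where "s = - d / (a + 1)"
    have d: "d = - (s * (a + 1))"
      using a by (simp add: s_def)
    have "0 \<le> s * d + s\<^sup>2 * a"
      using *[of s] by (simp add: d_def a_def)
    also have "\<dots> = - s\<^sup>2"
      by (simp add: d power2_eq_square algebra_simps)
    finally have "d = 0"
      by (simp add: d)
    then show ?thesis by (simp add: d_def)
  qed
  then show ?thesis by blast
qed

text \<open>Riesz for the real inner product gives \<open>S\<close> with the right real parts.
  Complex linearity of \<open>T\<close> supplies the imaginary parts, and then \<open>S\<close>
  inherits linearity and boundedness from the adjoint identity.\<close>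

lemma adjoint_exists:
  assumes T: "T \<in> bounded_ops"
  shows "\<exists>S\<in>bounded_ops. \<forall>x y. cinner (blinfun_apply T x) y = cinner x (blinfun_apply S y)"
proof -
  have "\<exists>w. \<forall>x. inner (blinfun_apply T x) y = inner x w" for y
    by (rule Riesz_representation_real)
      (intro bounded_linear_compose[OF bounded_linear_inner_left] blinfun.bounded_linear_right)
  then obtain S where S: "\<And>x y. inner (blinfun_apply T x) y = inner x (S y)"
    by metis
  have cS: "cinner (blinfun_apply T x) y = cinner x (S y)" for x y
  proof (rule complex_eqI)
    have Im: "Im (cinner u v) = - Re (cinner (\<i> *\<^sub>C u) v)" for u v :: 'a
      by (simp add: cinner_scaleC_left)
    show "Im (cinner (blinfun_apply T x) y) = Im (cinner x (S y))"
      using T by (simp add: Im Re_cinner bounded_ops_def flip: S)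
  qed (simp add: Re_cinner S)
  have cS': "cinner (S y) x = cinner y (blinfun_apply T x)" for x y
    by (metis cS cinner_commute)
  have lin: "S (y + z) = S y + S z" "S (c *\<^sub>C y) = c *\<^sub>C S y" for y z c
    by (rule cinner_eqI; simp add: cS' cinner_add_left cinner_scaleC_left)+
  have bnd: "norm (S y) \<le> norm y * norm T" for y
  proof (cases "S y = 0")
    case False
    have "norm (S y) * norm (S y) = inner (blinfun_apply T (S y)) y"
      by (simp add: S dot_square_norm power2_eq_square)
    also have "\<dots> \<le> norm (blinfun_apply T (S y)) * norm y"
      by (rule norm_cauchy_schwarz)
    also have "\<dots> \<le> norm T * norm (S y) * norm y"
      by (intro mult_right_mono norm_blinfun) simp
    finally show ?thesis
      using False by (simp add: mult.commute mult.left_commute)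
  qed simp
  have bl: "bounded_linear S"
    by (rule bounded_linear_intro[where K = "norm T"]) (simp_all add: lin bnd flip: scaleC_of_real)
  show ?thesis
    by (rule bexI[of _ "Blinfun S"])
      (simp_all add: bounded_linear_Blinfun_apply[OF bl] cS bounded_ops_def lin)
qed

text \<open>Inner products separate vectors, so the definite description in \<open>op_adj\<close> is
  met by at most one operator.\<close>

lemma op_adj_eqI:
  assumes "S \<in> bounded_ops" "\<And>x y. cinner (blinfun_apply T x) y = cinner x (blinfun_apply S y)"
  shows "op_adj T = S"
  unfolding op_adj_def
proof (rule the_equality)
  fix R assume R: "R \<in> bounded_ops \<and>
    (\<forall>x y. cinner (blinfun_apply T x) y = cinner x (blinfun_apply R y))"
  show "R = S"
    by (intro blinfun_eqI cinner_eqI) (metis R assms(2) cinner_commute)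
qed (use assms in auto)

lemma cinner_op_adj:
  assumes "T \<in> bounded_ops"
  shows "cinner (blinfun_apply T x) y = cinner x (blinfun_apply (op_adj T) y)"
  using adjoint_exists[OF assms] op_adj_eqI by metis

section \<open>Rank-one and compact operators\<close>

text \<open>The operator \<theta>(x, y) of the overview: linear in \<open>x\<close>,
  conjugate-linear in \<open>y\<close>.\<close>

lift_definition rank_one :: "'h::complex_hilbert \<Rightarrow> 'h \<Rightarrow> ('h \<Rightarrow>\<^sub>L 'h)"
  is "\<lambda>x y z. cinner z y *\<^sub>C x"
  by (rule bounded_linear_compose[OF bounded_linear_scaleC_left bounded_linear_cinner_left])

lemma norm_rank_one_le: "norm (rank_one x y) \<le> norm x * norm y"
proof (rule norm_blinfun_bound)
  fix z
  have "norm (blinfun_apply (rank_one x y) z) \<le> (norm z * norm y) * norm x"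
    by (auto simp: rank_one.rep_eq norm_scaleC intro: mult_right_mono cmod_cinner_le)
  then show "norm (blinfun_apply (rank_one x y) z) \<le> norm x * norm y * norm z"
    by (simp add: mult_ac)
qed simp

text \<open>A closed subset of a compact set is compact, so trapping the image of the unit ball in
  any compact \<open>K\<close> is enough.\<close>

lemma compact_opsI:
  assumes "T \<in> bounded_ops" "blinfun_apply T ` cball 0 1 \<subseteq> K" "compact K"
  shows "T \<in> compact_ops"
proof -
  have "closure (blinfun_apply T ` cball 0 1) \<subseteq> K"
    using assms by (simp add: closure_minimal compact_imp_closed)
  then have "compact (closure (blinfun_apply T ` cball 0 1))"
    using assms(3) closed_closure compact_Int_closed Int_absorb1 by metis
  then show ?thesis using assms(1) by (simp add: compact_ops_def)
qed

lemma compact_opsD: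
  assumes "T \<in> compact_ops"
  shows "T \<in> bounded_ops" "compact (closure (blinfun_apply T ` cball 0 1))"
    "x \<in> cball 0 1 \<Longrightarrow> blinfun_apply T x \<in> closure (blinfun_apply T ` cball 0 1)"
  using assms closure_subset[of "blinfun_apply T ` cball 0 1"] by (auto simp: compact_ops_def)

lemma rank_one_compact: "rank_one x y \<in> compact_ops"
proof (rule compact_opsI)
  show "rank_one x y \<in> bounded_ops"
    by (simp add: bounded_ops_def rank_one.rep_eq cinner_scaleC_left scaleC_scaleC)
  show "blinfun_apply (rank_one x y) ` cball 0 1 \<subseteq> (\<lambda>c. c *\<^sub>C x) ` cball 0 (norm y)"
  proof -
    have "cmod (cinner z y) \<le> norm y" if "norm z \<le> 1" for z
      using cmod_cinner_le[of z y] mult_right_mono[OF that, of "norm y"] by simp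
    then show ?thesis
      by (auto simp: rank_one.rep_eq)
  qed
  show "compact ((\<lambda>c. c *\<^sub>C x) ` cball 0 (norm y))"
    by (intro compact_continuous_image compact_cball linear_continuous_on bounded_linear_scaleC_left)
qed

lemma compact_ops_add:
  assumes "S \<in> compact_ops" "T \<in> compact_ops"
  shows "S + T \<in> compact_ops"
proof (rule compact_opsI)
  show "S + T \<in> bounded_ops"
    using assms[THEN compact_opsD(1)] by (auto simp: bounded_ops_def blinfun.add_left scaleC_add_right)
  show "blinfun_apply (S + T) ` cball 0 1 \<subseteq>
      {x + y |x y. x \<in> closure (blinfun_apply S ` cball 0 1) \<and> y \<in> closure (blinfun_apply T ` cball 0 1)}"
    using assms[THEN compact_opsD(3)] by (fastforce simp: blinfun.add_left)
qed (intro compact_sums assms[THEN compact_opsD(2)])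

lemma compact_ops_op_scaleC:
  assumes "T \<in> compact_ops"
  shows "op_scaleC c T \<in> compact_ops"
proof (rule compact_opsI)
  show "op_scaleC c T \<in> bounded_ops"
    using assms[THEN compact_opsD(1)]
    by (auto simp: bounded_ops_def op_scaleC.rep_eq scaleC_scaleC mult.commute)
  show "blinfun_apply (op_scaleC c T) ` cball 0 1 \<subseteq>
      (\<lambda>x. c *\<^sub>C x) ` closure (blinfun_apply T ` cball 0 1)"
    using assms[THEN compact_opsD(3)] by (auto simp: op_scaleC.rep_eq)
qed (intro compact_continuous_image linear_continuous_on bounded_linear_scaleC
      assms[THEN compact_opsD(2)])

lemma compact_ops_compose:
  assumes "S \<in> bounded_ops" "T \<in> compact_ops"
  shows "S o\<^sub>L T \<in> compact_ops"
proof (rule compact_opsI)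
  show "S o\<^sub>L T \<in> bounded_ops"
    using assms(1) assms(2)[THEN compact_opsD(1)] by (auto simp: bounded_ops_def)
  show "blinfun_apply (S o\<^sub>L T) ` cball 0 1 \<subseteq>
      blinfun_apply S ` closure (blinfun_apply T ` cball 0 1)"
    using assms(2)[THEN compact_opsD(3)] by auto
qed (intro compact_continuous_image linear_continuous_on blinfun.bounded_linear_right
      assms(2)[THEN compact_opsD(2)])

lemma op_scaleC_of_real: "op_scaleC (complex_of_real r) T = r *\<^sub>R T"
  by (rule blinfun_eqI) (simp add: op_scaleC.rep_eq blinfun.scaleR_left scaleC_of_real)

lemma norm_op_scaleC_le: "norm (op_scaleC c T) \<le> cmod c * norm T"
  by (rule norm_blinfun_bound)
    (simp_all add: op_scaleC.rep_eq norm_scaleC mult.assoc mult_left_mono norm_blinfun)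

lemma rank_one_add_left: "rank_one (x + y) z = rank_one x z + rank_one y z"
  by (rule blinfun_eqI) (simp add: rank_one.rep_eq blinfun.add_left scaleC_add_right)

lemma rank_one_zero_left [simp]: "rank_one 0 y = 0"
  by (rule blinfun_eqI) (simp add: rank_one.rep_eq linear_0 bounded_linear.linear[OF bounded_linear_scaleC])

lemma rank_one_scaleC_left: "rank_one (c *\<^sub>C x) z = op_scaleC c (rank_one x z)"
  by (rule blinfun_eqI)
    (simp add: rank_one.rep_eq op_scaleC.rep_eq scaleC_scaleC mult.commute)

text \<open>The identity behind the construction of \<open>implementer\<close>: left multiplication
  acts on the first vector only.\<close>

lemma blinfun_compose_rank_one:
  assumes "T \<in> bounded_ops"
  shows "T o\<^sub>L rank_one x y = rank_one (blinfun_apply T x) y"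
  using assms by (intro blinfun_eqI) (simp add: rank_one.rep_eq bounded_ops_def)

lemma bounded_linear_op_scaleC: "bounded_linear (op_scaleC c)"
  by (rule bounded_linear_intro[where K = "cmod c"])
    (auto simp: norm_op_scaleC_le mult.commute op_scaleC.rep_eq blinfun.add_left blinfun.scaleR_left
      scaleC_add_right scaleC_scaleR intro!: blinfun_eqI)

lemma op_adj_scaleR_rank_one: "op_adj (r *\<^sub>R rank_one x y) = r *\<^sub>R rank_one y x"
proof (rule op_adj_eqI)
  show "r *\<^sub>R rank_one y x \<in> bounded_ops"
    using compact_ops_op_scaleC[OF rank_one_compact, of "of_real r" y x]
    by (auto simp: op_scaleC_of_real dest: compact_opsD(1))
  show "cinner (blinfun_apply (r *\<^sub>R rank_one x y) u) v = cinner u (blinfun_apply (r *\<^sub>R rank_one y x) v)" for u v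
    using cinner_commute[of x v]
    by (simp add: blinfun.scaleR_left rank_one.rep_eq cinner_scaleC_left cinner_scaleC_right
        flip: scaleC_of_real)
qed

subsection \<open>Functions vanishing at infinity\<close>

text \<open>The space of functions vanishing at infinity with values in any normed space. Scalar
  bumps and operator-valued functions thereby share their closure properties.\<close>

definition C0_fun :: "'l topology \<Rightarrow> ('l \<Rightarrow> 'a::real_normed_vector) set" where
  "C0_fun \<tau> = {f. continuous_map \<tau> euclidean f \<and>
     (\<forall>e > 0. \<exists>K. compactin \<tau> K \<and> (\<forall>t \<in> topspace \<tau> - K. norm (f t) < e)) \<and>
     (\<forall>t. t \<notin> topspace \<tau> \<longrightarrow> f t = 0)}"

lemma C0_eq: "C0 \<tau> = {X \<in> C0_fun \<tau>. \<forall>t \<in> topspace \<tau>. X t \<in> compact_ops}"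
  by (auto simp: C0_def C0_fun_def)

lemma C0_fun_outside: "f \<in> C0_fun \<tau> \<Longrightarrow> t \<notin> topspace \<tau> \<Longrightarrow> f t = 0"
  by (simp add: C0_fun_def)

lemma C0_fun_tendsto: "f \<in> C0_fun \<tau> \<Longrightarrow> t \<in> topspace \<tau> \<Longrightarrow> (f \<longlongrightarrow> f t) (atin \<tau> t)"
  by (auto simp: C0_fun_def continuous_map_atin)

lemma C0_fun_vanish:
  assumes "f \<in> C0_fun \<tau>" "e > 0"
  obtains K where "compactin \<tau> K" "\<And>t. t \<notin> K \<Longrightarrow> norm (f t) < e"
proof -
  obtain K where K: "compactin \<tau> K" "\<forall>t \<in> topspace \<tau> - K. norm (f t) < e"
    using assms by (auto simp: C0_fun_def)
  show ?thesis
  proof (rule that[OF K(1)])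
    show "norm (f t) < e" if "t \<notin> K" for t
      using K that assms C0_fun_outside[OF assms(1), of t] by (cases "t \<in> topspace \<tau>") auto
  qed
qed

text \<open>Continuity of \<open>\<phi>\<close> at 0 turns smallness of \<open>f\<close> off a
  compact set into smallness of the composite; \<open>\<phi> 0 = 0\<close> also preserves the value
  0 outside the space.\<close>

lemma C0_fun_comp:
  fixes f :: "'l \<Rightarrow> 'a::real_normed_vector" and \<phi> :: "'a \<Rightarrow> 'b::real_normed_vector"
  assumes f: "f \<in> C0_fun \<tau>" and \<phi>: "continuous_on UNIV \<phi>" "\<phi> 0 = 0"
  shows "(\<lambda>t. \<phi> (f t)) \<in> C0_fun \<tau>"
proof -
  have cont: "continuous_map \<tau> euclidean (\<lambda>t. \<phi> (f t))"
    using continuous_map_compose[of \<tau> euclidean f euclidean \<phi>] f \<phi>(1)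
    by (simp add: C0_fun_def o_def)
  have "\<exists>K. compactin \<tau> K \<and> (\<forall>t \<in> topspace \<tau> - K. norm (\<phi> (f t)) < e)" if "e > 0" for e
  proof -
    obtain d where d: "d > 0" "\<And>x. norm x < d \<Longrightarrow> norm (\<phi> x) < e"
    proof -
      have "\<exists>d>0. \<forall>x. norm x < d \<longrightarrow> norm (\<phi> x) < e"
        using \<phi>(1)[unfolded continuous_on_iff, rule_format, of 0 e] \<open>e > 0\<close> \<phi>(2) by simp
      then show ?thesis
        using that by blast
    qed
    obtain K where "compactin \<tau> K" "\<And>t. t \<notin> K \<Longrightarrow> norm (f t) < d"
      using C0_fun_vanish[OF f d(1)] by blast
    then show ?thesis
      using d(2) by blast
  qed
  then show ?thesis
    using cont f \<phi>(2) by (simp add: C0_fun_def)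
qed

lemma C0_fun_Pair:
  assumes f: "f \<in> C0_fun \<tau>" and g: "g \<in> C0_fun \<tau>"
  shows "(\<lambda>t. (f t, g t)) \<in> C0_fun \<tau>"
proof -
  have "continuous_map \<tau> euclidean (\<lambda>t. (f t, g t))"
    using f g by (auto simp: C0_fun_def continuous_map_atin intro: tendsto_Pair)
  moreover have "\<exists>K. compactin \<tau> K \<and> (\<forall>t \<in> topspace \<tau> - K. norm (f t, g t) < e)" if "e > 0" for e
  proof -
    have e: "e / 2 > 0" using that by simp
    obtain K1 where K1: "compactin \<tau> K1" "\<And>t. t \<notin> K1 \<Longrightarrow> norm (f t) < e / 2"
      using C0_fun_vanish[OF f e] by blast
    obtain K2 where K2: "compactin \<tau> K2" "\<And>t. t \<notin> K2 \<Longrightarrow> norm (g t) < e / 2"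
      using C0_fun_vanish[OF g e] by blast
    have "norm (f t, g t) < e" if "t \<notin> K1 \<union> K2" for t
      using norm_Pair_le[of "f t" "g t"] K1(2)[of t] K2(2)[of t] that by simp
    then show ?thesis
      using compactin_Un[OF K1(1) K2(1)] by blast
  qed
  ultimately show ?thesis
    using f g by (simp add: C0_fun_def zero_prod_def)
qed

lemma C0_fun_comp2:
  assumes "f \<in> C0_fun \<tau>" "g \<in> C0_fun \<tau>" "continuous_on UNIV (\<lambda>(x, y). \<phi> x y)" "\<phi> 0 0 = 0"
  shows "(\<lambda>t. \<phi> (f t) (g t)) \<in> C0_fun \<tau>"
  using C0_fun_comp[OF C0_fun_Pair[OF assms(1,2)] assms(3)] assms(4) by (simp add: zero_prod_def)

lemma C0_fun_zero: "(\<lambda>_. 0) \<in> C0_fun \<tau>"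
  by (auto simp: C0_fun_def intro: exI[of _ "{}"])

lemma C0_fun_add: "f \<in> C0_fun \<tau> \<Longrightarrow> g \<in> C0_fun \<tau> \<Longrightarrow> (\<lambda>t. f t + g t) \<in> C0_fun \<tau>"
  by (rule C0_fun_comp2) (auto simp: case_prod_unfold intro!: continuous_intros)

lemma C0_fun_sum: "(\<And>i. i \<in> I \<Longrightarrow> f i \<in> C0_fun \<tau>) \<Longrightarrow> (\<lambda>t. \<Sum>i\<in>I. f i t) \<in> C0_fun \<tau>"
  by (induction I rule: infinite_finite_induct) (auto intro: C0_fun_zero C0_fun_add)

lemma C0_fun_bounded:
  assumes "f \<in> C0_fun \<tau>"
  shows "bounded (range f)"
proof -
  obtain K where K: "compactin \<tau> K" "\<And>t. t \<notin> K \<Longrightarrow> norm (f t) < 1"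
    using C0_fun_vanish[OF assms, of 1] by auto
  have "compactin euclidean (f ` K)"
    using assms by (intro image_compactin[OF K(1)]) (simp add: C0_fun_def)
  then have "bounded (f ` K \<union> cball 0 1)"
    by (simp add: compact_imp_bounded)
  moreover have "range f \<subseteq> f ` K \<union> cball 0 1"
  proof
    fix y assume "y \<in> range f"
    then obtain t where "y = f t" by blast
    then show "y \<in> f ` K \<union> cball 0 1"
      using K(2)[of t] by (cases "t \<in> K") auto
  qed
  ultimately show ?thesis
    by (rule bounded_subset)
qed

text \<open>Weierstrass M-test followed by continuity of uniform limits. It serves both the gliding
  hump series and the series defining the predual functionals.\<close>

lemma continuous_map_suminf:
  fixes f :: "nat \<Rightarrow> 'l \<Rightarrow> 'b::banach"
  assumes "\<And>n. continuous_map \<tau> euclidean (f n)"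
    "\<And>n t. t \<in> topspace \<tau> \<Longrightarrow> norm (f n t) \<le> M n" "summable M"
  shows "continuous_map \<tau> euclidean (\<lambda>t. \<Sum>n. f n t)"
proof -
  have ul: "uniform_limit (topspace \<tau>) (\<lambda>n t. \<Sum>i<n. f i t) (\<lambda>t. \<Sum>i. f i t) sequentially"
    using assms(2,3) by (rule Weierstrass_m_test)
  have "continuous_map \<tau> euclidean (\<lambda>t. \<Sum>i<n. f i t)" for n
    using assms(1) by (auto simp: continuous_map_atin intro: tendsto_sum)
  then have "\<forall>\<^sub>F n in sequentially. continuous_map \<tau> euclidean (\<lambda>t. \<Sum>i<n. f i t)"
    by (intro always_eventually allI)
  then show ?thesis
    by (rule Met_TC.continuous_map_uniform_limit[unfolded mtopology_is_euclidean])
      (use uniform_limitD[OF ul] in simp_all)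
qed

lemma C0_fun_suminf:
  fixes f :: "nat \<Rightarrow> 'l \<Rightarrow> 'b::banach"
  assumes f: "\<And>n. f n \<in> C0_fun \<tau>" and M: "\<And>n t. norm (f n t) \<le> M n" "summable M"
  shows "(\<lambda>t. \<Sum>n. f n t) \<in> C0_fun \<tau>"
proof -
  have "\<exists>K. compactin \<tau> K \<and> (\<forall>t \<in> topspace \<tau> - K. norm (\<Sum>n. f n t) < e)" if "e > 0" for e
  proof -
    have "uniform_limit UNIV (\<lambda>n t. \<Sum>i<n. f i t) (\<lambda>t. \<Sum>i. f i t) sequentially"
      using M by (rule Weierstrass_m_test)
    then have "\<forall>\<^sub>F n in sequentially. \<forall>t\<in>UNIV. dist (\<Sum>i<n. f i t) (\<Sum>i. f i t) < e / 2"
      using that by (intro uniform_limitD) auto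
    then obtain n where n: "\<And>t. dist (\<Sum>i<n. f i t) (\<Sum>i. f i t) < e / 2"
      by (auto simp: eventually_sequentially)
    obtain K where K: "compactin \<tau> K" "\<And>t. t \<notin> K \<Longrightarrow> norm (\<Sum>i<n. f i t) < e / 2"
      using C0_fun_vanish[OF C0_fun_sum half_gt_zero[OF \<open>e > 0\<close>], of "{..<n}" f] f by blast
    have "norm (\<Sum>i. f i t) < e" if "t \<notin> K" for t
      using n[of t] K(2)[OF that] norm_triangle_sub[of "\<Sum>i. f i t" "\<Sum>i<n. f i t"]
      by (simp add: dist_norm norm_minus_commute)
    then show ?thesis
      using K(1) by blast
  qed
  moreover have "continuous_map \<tau> euclidean (\<lambda>t. \<Sum>n. f n t)"
    using f M by (intro continuous_map_suminf) (auto simp: C0_fun_def)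
  ultimately show ?thesis
    using C0_fun_outside[OF f] by (simp add: C0_fun_def)
qed

text \<open>Locally compact Hausdorff spaces are completely regular, so \<open>t\<close> can be
  separated from the complement of an open neighbourhood \<open>U\<close> lying in a compact set
  \<open>K\<close>.\<close>

lemma bump_function:
  assumes "locally_compact_space \<tau>" "Hausdorff_space \<tau>" "t \<in> topspace \<tau>"
  shows "\<exists>f :: 'l \<Rightarrow> real. f \<in> C0_fun \<tau> \<and> f t = 1 \<and> (\<forall>s. 0 \<le> f s \<and> f s \<le> 1)"
proof -
  obtain U K where UK: "openin \<tau> U" "compactin \<tau> K" "t \<in> U" "U \<subseteq> K"
    using assms by (auto simp: locally_compact_space_def)
  have "completely_regular_space \<tau>"
    using assms locally_compact_regular_imp_completely_regular_space by blast
  moreover have "closedin \<tau> (topspace \<tau> - U)" "t \<in> topspace \<tau> - (topspace \<tau> - U)"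
    using UK assms by auto
  ultimately obtain g :: "'l \<Rightarrow> real" where g: "continuous_map \<tau> (top_of_set {0..1}) g" "g t = 0"
      "g ` (topspace \<tau> - U) \<subseteq> {1}"
    unfolding completely_regular_space_def by blast
  \<comment> \<open>Flipping \<open>g\<close> gives value 1 at \<open>t\<close> and 0 off
    \<open>U\<close>; the explicit 0 outside \<open>topspace \<tau>\<close> meets the convention for
    representatives.\<close>
  define f where "f s = (if s \<in> topspace \<tau> then 1 - g s else 0)" for s
  have gc: "continuous_map \<tau> euclidean g" and g01: "\<And>s. s \<in> topspace \<tau> \<Longrightarrow> 0 \<le> g s \<and> g s \<le> 1"
    using g(1) by (auto simp: continuous_map_in_subtopology)
  have "continuous_map \<tau> euclidean (\<lambda>s. 1 - g s)"
    using gc by (auto simp: continuous_map_atin intro: tendsto_intros)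
  then have "continuous_map \<tau> euclidean f"
    by (rule continuous_map_eq) (simp add: f_def)
  moreover have "f s = 0" if "s \<notin> K" for s
    using that g(3) UK by (auto simp: f_def)
  moreover from this have "\<forall>s \<in> topspace \<tau> - K. norm (f s) < e" if "e > 0" for e
    using that by simp
  moreover have "\<forall>s. s \<notin> topspace \<tau> \<longrightarrow> f s = 0"
    by (simp add: f_def)
  ultimately have "f \<in> C0_fun \<tau>"
    unfolding C0_fun_def using UK(2) by blast
  then show ?thesis
    using g(2) g01 assms(3) by (intro exI[of _ f]) (simp add: f_def)
qed

text \<open>For a bounded family, the series of a predual functional converges uniformly in
  \<open>t\<close>, so continuity of each \<open>Z t x\<close> passes to the sum.\<close>

lemma ultraweak_continuousI:
  fixes Z :: "'l \<Rightarrow> ('h::complex_hilbert \<Rightarrow>\<^sub>L 'h)"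
  assumes Z: "\<And>t. t \<in> topspace \<tau> \<Longrightarrow> Z t \<in> bounded_ops" and bdd: "bounded (Z ` topspace \<tau>)"
    and cont: "\<And>x. continuous_map \<tau> euclidean (\<lambda>t. blinfun_apply (Z t) x)"
  shows "continuous_map \<tau> ultraweak Z"
  unfolding ultraweak_def
proof (rule continuous_on_generated_topo)
  obtain B where B: "\<And>t. t \<in> topspace \<tau> \<Longrightarrow> norm (Z t) \<le> B" "B \<ge> 0"
    using bdd by (auto simp: bounded_pos intro: less_imp_le)
  have \<phi>: "continuous_map \<tau> euclidean (\<lambda>t. \<phi> (Z t))" if "\<phi> \<in> predual" for \<phi>
  proof -
    obtain x y :: "nat \<Rightarrow> 'h" where xy: "summable (\<lambda>n. (norm (x n))\<^sup>2)" "summable (\<lambda>n. (norm (y n))\<^sup>2)"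
      and \<phi>: "\<phi> = (\<lambda>T. \<Sum>n. cinner (blinfun_apply T (x n)) (y n))"
      using \<open>\<phi> \<in> predual\<close> unfolding predual_def by blast
    show ?thesis
      unfolding \<phi>
    proof (rule continuous_map_suminf)
      show "continuous_map \<tau> euclidean (\<lambda>t. cinner (blinfun_apply (Z t) (x n)) (y n))" for n
        using cont[of "x n"]
        by (auto simp: continuous_map_atin intro: bounded_linear.tendsto[OF bounded_linear_cinner_left])
      \<comment> \<open>The majorant for the M-test: a product of norms is at most the sum of their
        squares, and both families of squares are summable.\<close>
      show "summable (\<lambda>n. B * ((norm (x n))\<^sup>2 + (norm (y n))\<^sup>2))"
        by (intro summable_mult summable_add xy)
      show "cmod (cinner (blinfun_apply (Z t) (x n)) (y n)) \<le> B * ((norm (x n))\<^sup>2 + (norm (y n))\<^sup>2)"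
        if "t \<in> topspace \<tau>" for t n
      proof -
        have "cmod (cinner (blinfun_apply (Z t) (x n)) (y n)) \<le> norm (blinfun_apply (Z t) (x n)) * norm (y n)"
          by (rule cmod_cinner_le)
        also have "\<dots> \<le> (norm (Z t) * norm (x n)) * norm (y n)"
          by (intro mult_right_mono norm_blinfun) simp
        also have "\<dots> \<le> B * (norm (x n) * norm (y n))"
          unfolding mult.assoc using B(1)[OF that] by (intro mult_right_mono) simp_all
        also have "\<dots> \<le> B * ((norm (x n))\<^sup>2 + (norm (y n))\<^sup>2)"
        proof (intro mult_left_mono B(2))
          show "norm (x n) * norm (y n) \<le> (norm (x n))\<^sup>2 + (norm (y n))\<^sup>2"
            using sum_squares_bound[of "norm (x n)" "norm (y n)"]
              mult_nonneg_nonneg[OF norm_ge_zero norm_ge_zero, of "x n" "y n"] by linarith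
        qed
        finally show ?thesis .
      qed
    qed
  qed
  show "openin \<tau> (Z -` V \<inter> topspace \<tau>)"
    if "V \<in> {{T \<in> bounded_ops. \<phi> T \<in> U} |\<phi> U. \<phi> \<in> predual \<and> open U}" for V
  proof -
    obtain \<phi> U where V: "V = {T \<in> bounded_ops. \<phi> T \<in> U}" "\<phi> \<in> predual" "open U"
      using \<open>V \<in> _\<close> by blast
    have "openin \<tau> {t \<in> topspace \<tau>. \<phi> (Z t) \<in> U}"
      using openin_continuous_map_preimage[OF \<phi>[OF V(2)]] V(3) by simp
    moreover have "{t \<in> topspace \<tau>. \<phi> (Z t) \<in> U} = Z -` V \<inter> topspace \<tau>"
      using Z V(1) by auto
    ultimately show ?thesis by simp
  qed
  show "Z ` topspace \<tau> \<subseteq> \<Union> {{T \<in> bounded_ops. \<phi> T \<in> U} |\<phi> U. \<phi> \<in> predual \<and> open U}"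
    unfolding topspace_ultraweak[unfolded ultraweak_def topology_generated_by_topspace]
    using Z by blast
qed

section \<open>Algebraic operations on \<open>C0\<close>\<close>

text \<open>Outside the space the value is 0, which is compact too; this removes the side condition
  on \<open>t\<close>.\<close>

lemma C0_compact: "X \<in> C0 \<tau> \<Longrightarrow> X t \<in> compact_ops"
  using rank_one_compact[of 0 undefined] C0_fun_outside[of X \<tau> t]
  by (cases "t \<in> topspace \<tau>") (auto simp: C0_eq)

lemma C0_scaleR_const:
  assumes "g \<in> C0_fun \<tau>" "a \<in> compact_ops"
  shows "(\<lambda>t. g t *\<^sub>R a) \<in> C0 \<tau>"
proof -
  have "(\<lambda>t. g t *\<^sub>R a) \<in> C0_fun \<tau>"
    by (rule C0_fun_comp[OF assms(1)]) (intro continuous_intros, simp)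
  moreover have "r *\<^sub>R a \<in> compact_ops" for r
    using compact_ops_op_scaleC[OF assms(2), of "complex_of_real r"] unfolding op_scaleC_of_real .
  ultimately show ?thesis
    by (simp add: C0_eq)
qed

lemma C0_add: "X \<in> C0 \<tau> \<Longrightarrow> Y \<in> C0 \<tau> \<Longrightarrow> (\<lambda>t. X t + Y t) \<in> C0 \<tau>"
  by (simp add: C0_eq C0_fun_add compact_ops_add)

lemma C0_op_scaleC:
  assumes "X \<in> C0 \<tau>"
  shows "(\<lambda>t. op_scaleC c (X t)) \<in> C0 \<tau>"
proof -
  have "(\<lambda>t. op_scaleC c (X t)) \<in> C0_fun \<tau>"
  proof (rule C0_fun_comp[where \<phi> = "op_scaleC c"])
    show "X \<in> C0_fun \<tau>"
      using assms by (simp add: C0_eq)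
    show "continuous_on UNIV (op_scaleC c)"
      by (rule linear_continuous_on[OF bounded_linear_op_scaleC])
    show "op_scaleC c 0 = 0"
      by (rule linear_0[OF bounded_linear.linear[OF bounded_linear_op_scaleC]])
  qed
  then show ?thesis
    using assms by (simp add: C0_eq compact_ops_op_scaleC)
qed

lemma C0_compose:
  assumes "X \<in> C0 \<tau>" "Y \<in> C0 \<tau>"
  shows "(\<lambda>t. X t o\<^sub>L Y t) \<in> C0 \<tau>"
proof -
  have "continuous_on UNIV (\<lambda>(S :: 'b \<Rightarrow>\<^sub>L 'b, T :: 'b \<Rightarrow>\<^sub>L 'b). S o\<^sub>L T)"
    unfolding case_prod_unfold
    by (rule bounded_bilinear.continuous_on[OF bounded_bilinear_blinfun_compose
          continuous_on_fst[OF continuous_on_id] continuous_on_snd[OF continuous_on_id]])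
  then have "(\<lambda>t. X t o\<^sub>L Y t) \<in> C0_fun \<tau>"
    using assms by (intro C0_fun_comp2[where \<phi> = "(o\<^sub>L)"]) (simp_all add: C0_eq)
  moreover have "X t o\<^sub>L Y t \<in> compact_ops" for t
    using assms by (intro compact_ops_compose compact_opsD(1)[OF C0_compact] C0_compact)
  ultimately show ?thesis
    by (simp add: C0_eq)
qed

subsection \<open>Derivations\<close>

text \<open>The unit vector \<open>\<xi>\<close> presupposes a nonzero Hilbert space; the zero space
  is handled separately in the theorem.\<close>

locale C0_derivation =
  fixes \<tau> :: "'l topology"
    and D :: "('l \<Rightarrow> ('h::complex_hilbert \<Rightarrow>\<^sub>L 'h)) \<Rightarrow> ('l \<Rightarrow> ('h \<Rightarrow>\<^sub>L 'h))"
    and \<xi> :: 'h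
  assumes lc: "locally_compact_space \<tau>" and haus: "Hausdorff_space \<tau>"
    and der: "derivation \<tau> D" and unit: "norm \<xi> = 1"
begin

lemma D_in: "X \<in> C0 \<tau> \<Longrightarrow> D X \<in> C0 \<tau>"
  and D_add: "X \<in> C0 \<tau> \<Longrightarrow> Y \<in> C0 \<tau> \<Longrightarrow> D (\<lambda>t. X t + Y t) = (\<lambda>t. D X t + D Y t)"
  and D_scaleC: "X \<in> C0 \<tau> \<Longrightarrow> D (\<lambda>t. op_scaleC c (X t)) = (\<lambda>t. op_scaleC c (D X t))"
  and D_mult: "X \<in> C0 \<tau> \<Longrightarrow> Y \<in> C0 \<tau> \<Longrightarrow>
    D (\<lambda>t. X t o\<^sub>L Y t) = (\<lambda>t. (D X t o\<^sub>L Y t) + (X t o\<^sub>L D Y t))"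
  using der unfolding derivation_def by blast+

lemma cinner_unit [simp]: "cinner \<xi> \<xi> = 1"
  by (simp add: cinner_self unit)

section \<open>Locality of derivations\<close>

text \<open>The function is a product of two factors, each carrying \<open>sqrt (g s)\<close> and
  linked through \<open>\<xi>\<close>. Both factors vanish at \<open>t\<close>, hence so do both
  terms of the Leibniz rule.\<close>

lemma D_rank_one_nonneg:
  assumes g: "g \<in> C0_fun \<tau>" "\<And>s. 0 \<le> g s" "g t = 0"
  shows "D (\<lambda>s. g s *\<^sub>R rank_one x y) t = 0"
proof -
  have h: "(\<lambda>s. sqrt (g s)) \<in> C0_fun \<tau>"
    by (rule C0_fun_comp[OF g(1)]) (auto intro: continuous_intros)
  have "g s *\<^sub>R rank_one x y = (sqrt (g s) *\<^sub>R rank_one x \<xi>) o\<^sub>L (sqrt (g s) *\<^sub>R rank_one \<xi> y)" for s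
    using g(2)[of s]
    by (intro blinfun_eqI) (simp add: blinfun.scaleR_left rank_one.rep_eq cinner_scaleC_left
        cinner_scaleR_left scaleC_scaleR scaleC_scaleR_left)
  then show ?thesis
    using g(3) by (simp add: D_mult C0_scaleR_const h rank_one_compact)
qed

text \<open>Splits \<open>g\<close> into positive and negative parts; the sign of the latter is
  moved into the vector \<open>x\<close>, so that both coefficients are nonnegative.\<close>

lemma D_rank_one_local:
  assumes g: "g \<in> C0_fun \<tau>" "g t = 0"
  shows "D (\<lambda>s. g s *\<^sub>R rank_one x y) t = 0"
proof -
  have p: "(\<lambda>s. max 0 (g s)) \<in> C0_fun \<tau>" and n: "(\<lambda>s. max 0 (- g s)) \<in> C0_fun \<tau>"
    by (rule C0_fun_comp[OF g(1)]; auto intro!: continuous_intros)+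
  have "g s *\<^sub>R rank_one x y =
      max 0 (g s) *\<^sub>R rank_one x y + max 0 (- g s) *\<^sub>R rank_one (- x) y" for s
  proof -
    have "rank_one (- x) y = - rank_one x y"
      using rank_one_add_left[of x "- x" y] by (simp add: eq_neg_iff_add_eq_0 add.commute)
    then show ?thesis
      by (simp add: max_def)
  qed
  then show ?thesis
    using D_rank_one_nonneg[OF p, of t x y] D_rank_one_nonneg[OF n, of t "- x" y] g(2)
    by (simp add: D_add C0_scaleR_const p n rank_one_compact)
qed

text \<open>Sandwiching \<open>X\<close> between rank-one operators turns it into a scalar function times a fixed
  rank-one operator, for which the square root argument applies.\<close>

lemma D_local_zero:
  assumes X: "X \<in> C0 \<tau>" "X t = 0" and t: "t \<in> topspace \<tau>"
  shows "D X t = 0"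
proof (rule blinfun_eqI)
  fix y
  \<comment> \<open>The vector \<open>v\<close> is to be shown zero. With \<open>P\<close> and
    \<open>Q\<close> built from \<open>v\<close> and \<open>y\<close>, the operator
    \<open>P t D X t Q t\<close> sends \<open>y\<close> to a positive multiple of \<open>v\<close>
    unless \<open>y\<close> or \<open>v\<close> is zero.\<close>
  define v where "v = blinfun_apply (D X t) y"
  obtain f :: "'l \<Rightarrow> real" where f: "f \<in> C0_fun \<tau>" "f t = 1"
    using bump_function[OF lc haus t] by blast
  define P where "P s = f s *\<^sub>R rank_one v v" for s
  define Q where "Q s = f s *\<^sub>R rank_one y y" for s
  have PQ: "P \<in> C0 \<tau>" "Q \<in> C0 \<tau>"
    unfolding P_def Q_def by (intro C0_scaleR_const f rank_one_compact)+
  have XQ: "(\<lambda>s. X s o\<^sub>L Q s) \<in> C0 \<tau>"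
    by (intro C0_compose X PQ)
  define g where "g s = cinner (blinfun_apply (X s) y) v" for s
  \<comment> \<open>The locality lemma takes real coefficients, so the complex function
    \<open>g\<close> enters through \<open>Re\<close> and \<open>Im\<close>; the square of
    \<open>f\<close> collects the bumps of \<open>P\<close> and \<open>Q\<close>.\<close>
  have gC: "(\<lambda>s. (f s)\<^sup>2 * r (g s)) \<in> C0_fun \<tau>" if "bounded_linear r" for r :: "complex \<Rightarrow> real"
    unfolding g_def
  proof (rule C0_fun_comp2[OF f(1), where \<phi> = "\<lambda>a b. a\<^sup>2 * r (cinner (blinfun_apply b y) v)"])
    show "X \<in> C0_fun \<tau>" using X by (simp add: C0_eq)
    show "continuous_on UNIV (\<lambda>(a, b). a\<^sup>2 * r (cinner (blinfun_apply b y) v))"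
      unfolding case_prod_unfold
      by (intro continuous_intros bounded_linear.continuous_on[OF that]
          bounded_linear.continuous_on[OF bounded_linear_cinner_left])
  qed simp
  have "P s o\<^sub>L (X s o\<^sub>L Q s) = ((f s)\<^sup>2 * Re (g s)) *\<^sub>R rank_one v y
      + ((f s)\<^sup>2 * Im (g s)) *\<^sub>R rank_one (\<i> *\<^sub>C v) y" for s
  proof -
    have Xc: "blinfun_apply (X s) (c *\<^sub>C z) = c *\<^sub>C blinfun_apply (X s) z" for c z
      using compact_opsD(1)[OF C0_compact[OF X(1)], of s] by (simp add: bounded_ops_def)
    show ?thesis
    proof (rule blinfun_eqI)
      fix z
      have g: "g s = of_real (Re (g s)) + of_real (Im (g s)) * \<i>"
        by (simp add: complex_eq_iff)
      have "blinfun_apply (P s o\<^sub>L (X s o\<^sub>L Q s)) z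
          = (of_real (f s) * (cinner z y * of_real (f s) * g s)) *\<^sub>C v"
        by (simp add: P_def Q_def blinfun.scaleR_left blinfun.scaleR_right rank_one.rep_eq Xc
            cinner_scaleC_left cinner_scaleR_left g_def scaleR_conv_of_real scaleC_scaleC mult_ac
            flip: scaleC_of_real)
      also have "\<dots> = blinfun_apply (((f s)\<^sup>2 * Re (g s)) *\<^sub>R rank_one v y
      + ((f s)\<^sup>2 * Im (g s)) *\<^sub>R rank_one (\<i> *\<^sub>C v) y) z"
        by (subst g, simp add: blinfun.add_left blinfun.scaleR_left rank_one.rep_eq scaleC_scaleC
            flip: scaleC_of_real scaleC_add_left, simp add: power2_eq_square algebra_simps)
      finally show "blinfun_apply (P s o\<^sub>L (X s o\<^sub>L Q s)) z = blinfun_apply (((f s)\<^sup>2 * Re (g s)) *\<^sub>R rank_one v y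
      + ((f s)\<^sup>2 * Im (g s)) *\<^sub>R rank_one (\<i> *\<^sub>C v) y) z" .
    qed
  qed
  moreover have "g t = 0"
    by (simp add: g_def X(2))
  ultimately have "D (\<lambda>s. P s o\<^sub>L (X s o\<^sub>L Q s)) t = 0"
    using D_rank_one_local[OF gC[OF bounded_linear_Re], of t v y]
      D_rank_one_local[OF gC[OF bounded_linear_Im], of t "\<i> *\<^sub>C v" y]
    by (simp add: D_add C0_scaleR_const gC bounded_linear_Re bounded_linear_Im rank_one_compact)
  \<comment> \<open>Of the three Leibniz terms, the two in which \<open>D\<close> hits
    \<open>P\<close> or \<open>Q\<close> retain the factor \<open>X t = 0\<close>.\<close>
  moreover have "D (\<lambda>s. P s o\<^sub>L (X s o\<^sub>L Q s)) t = P t o\<^sub>L (D X t o\<^sub>L Q t)"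
    using X(2) by (simp add: D_mult[OF PQ(1) XQ] D_mult[OF X(1) PQ(2)])
  ultimately have "blinfun_apply (P t o\<^sub>L (D X t o\<^sub>L Q t)) y = 0"
    by simp
  moreover have "blinfun_apply (D X t) (cinner y y *\<^sub>C y) = cinner y y *\<^sub>C v"
    using compact_opsD(1)[OF C0_compact[OF D_in[OF X(1)]], of t]
    by (simp add: bounded_ops_def v_def)
  ultimately have "cinner (cinner y y *\<^sub>C v) v *\<^sub>C v = 0"
    by (simp add: P_def Q_def f rank_one.rep_eq)
  then have "cmod (cinner (cinner y y *\<^sub>C v) v) * norm v = 0"
    by (metis norm_scaleC norm_zero)
  then have "y = 0 \<or> v = 0"
    by (auto simp: cinner_scaleC_left cinner_self)
  then show "blinfun_apply (D X t) y = blinfun_apply 0 y"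
    by (auto simp: v_def)
qed

text \<open>Apply \<open>D_local_zero\<close> to the difference, with negation expressed as complex
  scaling by -1.\<close>

lemma D_local:
  assumes "X \<in> C0 \<tau>" "Y \<in> C0 \<tau>" "t \<in> topspace \<tau>" "X t = Y t"
  shows "D X t = D Y t"
proof -
  have m: "op_scaleC (- 1) T = - T" for T :: "'h \<Rightarrow>\<^sub>L 'h"
    using op_scaleC_of_real[of "- 1" T] by simp
  have Y: "(\<lambda>s. - Y s) \<in> C0 \<tau>" "D (\<lambda>s. - Y s) = (\<lambda>s. - D Y s)"
    using C0_op_scaleC[OF assms(2), of "- 1"] D_scaleC[OF assms(2), of "- 1"] by (simp_all add: m)
  have "D (\<lambda>s. X s + - Y s) t = 0"
    using assms Y by (intro D_local_zero C0_add) auto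
  then show ?thesis
    using D_add[OF assms(1) Y(1)] Y(2) by simp
qed

section \<open>The fibre derivations\<close>

definition bump :: "'l \<Rightarrow> 'l \<Rightarrow> real" where
  "bump t = (SOME f. f \<in> C0_fun \<tau> \<and> f t = 1 \<and> (\<forall>s. 0 \<le> f s \<and> f s \<le> 1))"

lemma bump:
  assumes "t \<in> topspace \<tau>"
  shows "bump t \<in> C0_fun \<tau>" "bump t t = 1" "0 \<le> bump t s" "bump t s \<le> 1"
  using someI_ex[OF bump_function[OF lc haus assms], folded bump_def] by auto

text \<open>The fibre derivation \<open>D\<^sub>t\<close> of the overview. By
  \<open>D_local\<close>, at a point of the space any other extension of \<open>a\<close> to an
  element of \<open>C0 \<tau>\<close> gives the same value.\<close>

definition deriv_at :: "'l \<Rightarrow> ('h \<Rightarrow>\<^sub>L 'h) \<Rightarrow> ('h \<Rightarrow>\<^sub>L 'h)" where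
  "deriv_at t a = D (\<lambda>s. bump t s *\<^sub>R a) t"

lemma D_eq_deriv_at:
  assumes "X \<in> C0 \<tau>" "t \<in> topspace \<tau>"
  shows "D X t = deriv_at t (X t)"
  unfolding deriv_at_def using assms
  by (intro D_local) (auto simp: bump C0_scaleR_const C0_compact)

lemma deriv_at_compact:
  assumes "t \<in> topspace \<tau>" "a \<in> compact_ops"
  shows "deriv_at t a \<in> compact_ops"
  unfolding deriv_at_def using assms by (intro C0_compact[OF D_in] C0_scaleR_const bump)

text \<open>The bump is 1 at \<open>t\<close>, so the sum of the two extensions takes the value
  \<open>a + b\<close> there and \<open>D_eq_deriv_at\<close> applies. Scalars and products are
  treated in the same way.\<close>

lemma deriv_at_add:
  assumes "t \<in> topspace \<tau>" "a \<in> compact_ops" "b \<in> compact_ops"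
  shows "deriv_at t (a + b) = deriv_at t a + deriv_at t b"
  using fun_cong[OF D_add[of "\<lambda>s. bump t s *\<^sub>R a" "\<lambda>s. bump t s *\<^sub>R b"], of t]
    D_eq_deriv_at[OF C0_add[of "\<lambda>s. bump t s *\<^sub>R a" \<tau> "\<lambda>s. bump t s *\<^sub>R b"], of t] assms
  by (simp add: bump C0_scaleR_const D_eq_deriv_at)

lemma deriv_at_scaleC:
  assumes "t \<in> topspace \<tau>" "a \<in> compact_ops"
  shows "deriv_at t (op_scaleC c a) = op_scaleC c (deriv_at t a)"
  using fun_cong[OF D_scaleC[of "\<lambda>s. bump t s *\<^sub>R a" c], of t]
    D_eq_deriv_at[OF C0_op_scaleC[of "\<lambda>s. bump t s *\<^sub>R a" \<tau> c], of t] assms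
  by (simp add: bump C0_scaleR_const D_eq_deriv_at)

lemma deriv_at_mult:
  assumes "t \<in> topspace \<tau>" "a \<in> compact_ops" "b \<in> compact_ops"
  shows "deriv_at t (a o\<^sub>L b) = (deriv_at t a o\<^sub>L b) + (a o\<^sub>L deriv_at t b)"
  using fun_cong[OF D_mult[of "\<lambda>s. bump t s *\<^sub>R a" "\<lambda>s. bump t s *\<^sub>R b"], of t]
    D_eq_deriv_at[OF C0_compose[of "\<lambda>s. bump t s *\<^sub>R a" \<tau> "\<lambda>s. bump t s *\<^sub>R b"], of t] assms
  by (simp add: bump C0_scaleR_const D_eq_deriv_at)

lemma D_scaleR_const:
  assumes "t \<in> topspace \<tau>" "a \<in> compact_ops" "g \<in> C0_fun \<tau>"
  shows "D (\<lambda>s. g s *\<^sub>R a) t = g t *\<^sub>R deriv_at t a"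
  using deriv_at_scaleC[OF assms(1,2), of "of_real (g t)"] assms
  by (simp add: D_eq_deriv_at C0_scaleR_const op_scaleC_of_real)

text \<open>A gliding hump argument: were the fibre derivatives of \<open>a\<close> unbounded, a scalar function
  \<open>g\<close> in \<open>C0_fun \<tau>\<close> decaying slowly along the bad points would make \<open>D (g a)\<close> unbounded.\<close>

lemma deriv_at_bounded:
  assumes a: "a \<in> compact_ops"
  shows "bounded ((\<lambda>t. deriv_at t a) ` topspace \<tau>)"
proof (rule ccontr)
  assume "\<not> ?thesis"
  \<comment> \<open>Growth \<open>4 ^ n\<close> against the weights \<open>(1 / 2) ^ n\<close> below
    still leaves \<open>2 ^ n\<close>, which is unbounded.\<close>
  then have "\<exists>t\<in>topspace \<tau>. norm (deriv_at t a) > 4 ^ n" for n :: nat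
    by (auto simp: bounded_iff not_le)
  then obtain T where T: "\<And>n. T n \<in> topspace \<tau>" "\<And>n :: nat. norm (deriv_at (T n) a) > 4 ^ n"
    by metis
  define h where "h n s = (1 / 2) ^ n * bump (T n) s" for n s
  define g where "g s = (\<Sum>n. h n s)" for s
  have hC: "h n \<in> C0_fun \<tau>" for n
    unfolding h_def by (rule C0_fun_comp[OF bump(1)[OF T(1)]]) (auto intro: continuous_intros)
  have h: "0 \<le> h n s" "h n s \<le> (1 / 2) ^ n" for n s
    unfolding h_def using bump(3,4)[OF T(1)] by (auto simp: mult_left_le)
  have g: "g \<in> C0_fun \<tau>"
    unfolding g_def
  proof (rule C0_fun_suminf[OF hC])
    show "norm (h n s) \<le> (1 / 2) ^ n" for n s
      using h[of n s] by simp
    show "summable (\<lambda>n. (1 / 2 :: real) ^ n)"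
      by (rule summable_geometric) simp
  qed
  \<comment> \<open>All summands are nonnegative, so \<open>g\<close> at \<open>T n\<close>
    dominates its \<open>n\<close>-th summand even where bumps overlap.\<close>
  have hg: "(1 / 2) ^ n \<le> g (T n)" for n
  proof -
    have "summable (\<lambda>i. h i (T n))"
    proof (rule summable_comparison_test')
      show "summable (\<lambda>n. (1 / 2 :: real) ^ n)"
        by (rule summable_geometric) simp
      show "norm (h i (T n)) \<le> (1 / 2) ^ i" for i
        using h[of i "T n"] by simp
    qed
    then have "h n (T n) \<le> g (T n)"
      unfolding g_def using sum_le_suminf[of "\<lambda>i. h i (T n)" "{n}"] h by auto
    then show ?thesis
      using bump(2)[OF T(1)] by (simp add: h_def)
  qed
  have "bounded (range (D (\<lambda>s. g s *\<^sub>R a)))"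
    using D_in[OF C0_scaleR_const[OF g a]] by (intro C0_fun_bounded[of _ \<tau>]) (simp add: C0_eq)
  then obtain B where B: "\<And>t. norm (D (\<lambda>s. g s *\<^sub>R a) t) \<le> B"
    by (auto simp: bounded_iff)
  have "2 ^ n \<le> B" for n
  proof -
    have "(2 :: real) ^ n = (1 / 2) ^ n * 4 ^ n"
      by (simp flip: power_mult_distrib)
    also have "\<dots> \<le> g (T n) * norm (deriv_at (T n) a)"
      using hg[of n] T(2)[of n] order_trans[OF _ hg[of n], of 0] by (intro mult_mono) auto
    also have "\<dots> = norm (D (\<lambda>s. g s *\<^sub>R a) (T n))"
      using order_trans[OF _ hg[of n], of 0] by (simp add: D_scaleR_const T a g)
    finally show ?thesis
      using B[of "T n"] by simp
  qed
  moreover obtain n where "B < 2 ^ n"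
    using real_arch_pow[of 2 B] by auto
  ultimately show False
    by (meson not_le)
qed

section \<open>The implementing operators: bounds and continuity\<close>

text \<open>Kept as a plain function until \<open>implementer_bounded\<close> provides the bound
  that lets \<open>Z\<close> package it as an operator.\<close>

definition implementer :: "'l \<Rightarrow> 'h \<Rightarrow> 'h" where
  "implementer t x = blinfun_apply (deriv_at t (rank_one x \<xi>)) \<xi>"

text \<open>Leibniz rule for \<open>a o\<^sub>L rank_one x \<xi>\<close>, which equals
  \<open>rank_one (a x) \<xi>\<close>, evaluated at \<open>\<xi>\<close>; there
  \<open>rank_one x \<xi>\<close> returns \<open>x\<close>.\<close>

lemma deriv_at_apply:
  assumes "t \<in> topspace \<tau>" "a \<in> compact_ops"
  shows "blinfun_apply (deriv_at t a) x = implementer t (blinfun_apply a x) - blinfun_apply a (implementer t x)"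
proof -
  have "deriv_at t (rank_one (blinfun_apply a x) \<xi>)
      = (deriv_at t a o\<^sub>L rank_one x \<xi>) + (a o\<^sub>L deriv_at t (rank_one x \<xi>))"
    using deriv_at_mult[OF assms rank_one_compact] compact_opsD(1)[OF assms(2)]
    by (simp add: blinfun_compose_rank_one)
  then show ?thesis
    by (simp add: implementer_def blinfun.add_left rank_one.rep_eq)
qed

lemma implementer_add: "t \<in> topspace \<tau> \<Longrightarrow> implementer t (x + y) = implementer t x + implementer t y"
  by (simp add: implementer_def rank_one_add_left deriv_at_add rank_one_compact blinfun.add_left)

lemma implementer_scaleC: "t \<in> topspace \<tau> \<Longrightarrow> implementer t (c *\<^sub>C x) = c *\<^sub>C implementer t x"
  by (simp add: implementer_def rank_one_scaleC_left deriv_at_scaleC rank_one_compact op_scaleC.rep_eq)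

lemma implementer_scaleR: "t \<in> topspace \<tau> \<Longrightarrow> implementer t (r *\<^sub>R x) = r *\<^sub>R implementer t x"
  using implementer_scaleC[of t "of_real r" x] by (simp add: scaleC_of_real)

lemma norm_implementer_le: "norm (implementer t x) \<le> norm (deriv_at t (rank_one x \<xi>))"
  unfolding implementer_def using norm_blinfun[of _ \<xi>] by (simp add: unit)

lemma implementer_bound_scale:
  assumes t: "t \<in> topspace \<tau>" and B: "\<And>y. norm y \<le> 1 \<Longrightarrow> norm (implementer t y) \<le> B"
  shows "norm (implementer t x) \<le> B * norm x"
proof (cases "x = 0")
  case True
  then show ?thesis using implementer_scaleR[OF t, of 0 0] by simp
next
  case False
  have "norm (implementer t (norm x *\<^sub>R (inverse (norm x) *\<^sub>R x))) \<le> norm x * B"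
    unfolding implementer_scaleR[OF t, of "norm x"] norm_scaleR
    using B[of "inverse (norm x) *\<^sub>R x"] False by (simp add: mult_left_mono)
  then show ?thesis
    using False by (simp add: mult.commute)
qed

text \<open>The test function, a bump times \<open>rank_one x \<xi>\<close>, lies in the unit ball
  of \<open>C0 \<tau>\<close>, so the constant in front of \<open>map_norm\<close> is 1.\<close>

lemma implementer_le_map_norm:
  assumes t: "t \<in> topspace \<tau>" and x: "norm x \<le> 1"
  shows "ennreal (norm (implementer t x)) \<le> map_norm \<tau> D"
proof -
  define X where "X = (\<lambda>s. bump t s *\<^sub>R rank_one x \<xi>)"
  have X: "X \<in> C0 \<tau>"
    unfolding X_def by (intro C0_scaleR_const bump t rank_one_compact)
  have "norm (rank_one x \<xi>) \<le> 1"
    using norm_rank_one_le[of x \<xi>] x unit by simp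
  then have "norm (X s) \<le> 1" for s
    using bump(3,4)[OF t, of s] by (simp add: X_def mult_le_one)
  then have "sup_norm \<tau> X \<le> 1"
    unfolding sup_norm_def by (intro SUP_least) (simp add: ennreal_le_1)
  then have "sup_norm \<tau> (D X) \<le> map_norm \<tau> D"
    unfolding map_norm_def using X by (intro SUP_upper) simp
  moreover have "ennreal (norm (D X t)) \<le> sup_norm \<tau> (D X)"
    unfolding sup_norm_def using t by (rule SUP_upper)
  moreover have "norm (implementer t x) \<le> norm (D X t)"
    using norm_implementer_le[of t x] by (simp add: deriv_at_def X_def)
  ultimately show ?thesis
    by (meson ennreal_leI order_trans)
qed

text \<open>Uniform boundedness for the set \<open>W\<close> of all values on the unit ball, over
  all \<open>t\<close> at once. Weak boundedness in direction \<open>v\<close> comes from the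
  gliding hump bounds for \<open>rank_one \<xi> \<xi>\<close> and
  \<open>rank_one \<xi> v\<close>.\<close>

lemma implementer_bounded: "\<exists>B. \<forall>t\<in>topspace \<tau>. \<forall>x. norm (implementer t x) \<le> B * norm x"
proof -
  define W where "W = (\<lambda>(t, x). implementer t x) ` (topspace \<tau> \<times> cball 0 1)"
  obtain M where M: "\<And>t. t \<in> topspace \<tau> \<Longrightarrow> norm (deriv_at t (rank_one \<xi> \<xi>)) \<le> M"
    using deriv_at_bounded[OF rank_one_compact, of \<xi> \<xi>] by (auto simp: bounded_iff)
  have "bounded ((\<lambda>w. inner w v) ` W)" for v
  proof -
    obtain N where N: "\<And>t. t \<in> topspace \<tau> \<Longrightarrow> norm (deriv_at t (rank_one \<xi> v)) \<le> N"
      using deriv_at_bounded[OF rank_one_compact, of \<xi> v] by (auto simp: bounded_iff)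
    have "\<bar>inner (implementer t y) v\<bar> \<le> norm v * M + N" if t: "t \<in> topspace \<tau>" and y: "norm y \<le> 1" for t y
    proof -
      have "\<bar>inner (implementer t y) v\<bar> \<le> cmod (cinner (implementer t y) v)"
        by (metis Re_cinner abs_Re_le_cmod)
      also have "\<dots> = norm (cinner (implementer t y) v *\<^sub>C \<xi>)"
        by (simp add: norm_scaleC unit)
      \<comment> \<open>This is \<open>deriv_at_apply\<close> for \<open>rank_one \<xi> v\<close>,
        solved for the term in which that operator acts on \<open>implementer t y\<close>.\<close>
      also have "cinner (implementer t y) v *\<^sub>C \<xi>
          = cinner y v *\<^sub>C implementer t \<xi> - blinfun_apply (deriv_at t (rank_one \<xi> v)) y"
        using deriv_at_apply[OF t rank_one_compact, of \<xi> v y] by (simp add: rank_one.rep_eq implementer_scaleC[OF t])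
      also have "norm \<dots> \<le> cmod (cinner y v) * norm (implementer t \<xi>) + norm (blinfun_apply (deriv_at t (rank_one \<xi> v)) y)"
        by (metis norm_scaleC norm_triangle_ineq4)
      also have "\<dots> \<le> norm v * M + N"
      proof (intro add_mono mult_mono)
        show "cmod (cinner y v) \<le> norm v"
          using cmod_cinner_le[of y v] mult_right_mono[OF y, of "norm v"] by simp
        show "norm (implementer t \<xi>) \<le> M"
          using norm_implementer_le[of t \<xi>] M[OF t] by simp
        show "norm (blinfun_apply (deriv_at t (rank_one \<xi> v)) y) \<le> N"
          using norm_blinfun[of "deriv_at t (rank_one \<xi> v)" y] N[OF t]
            mult_left_le[OF y, of "norm (deriv_at t (rank_one \<xi> v))"] by simp
      qed simp_all
      finally show ?thesis .
    qed
    then show ?thesis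
      by (auto simp: bounded_iff W_def intro!: exI[of _ "norm v * M + N"])
  qed
  then have "bounded W"
    by (rule weakly_bounded_imp_bounded)
  then obtain B where "\<And>w. w \<in> W \<Longrightarrow> norm w \<le> B"
    by (auto simp: bounded_iff)
  then have "norm (implementer t y) \<le> B" if "t \<in> topspace \<tau>" "norm y \<le> 1" for t y
    using that unfolding W_def by (metis (no_types, lifting) SigmaI case_prod_conv imageI mem_cball_0)
  then show ?thesis
    using implementer_bound_scale by blast
qed

definition Z :: "'l \<Rightarrow> ('h \<Rightarrow>\<^sub>L 'h)" where
  "Z t = (if t \<in> topspace \<tau> then Blinfun (implementer t) else 0)"

lemma Z_apply:
  assumes t: "t \<in> topspace \<tau>"
  shows "blinfun_apply (Z t) = implementer t"
proof -
  obtain B where "\<And>x. norm (implementer t x) \<le> B * norm x"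
    using implementer_bounded t by blast
  then have "bounded_linear (implementer t)"
    by (intro bounded_linear_intro[where K = B]) (simp_all add: implementer_add implementer_scaleR t mult.commute)
  then show ?thesis
    using t by (simp add: Z_def bounded_linear_Blinfun_apply)
qed

lemma Z_bounded_ops: "t \<in> topspace \<tau> \<Longrightarrow> Z t \<in> bounded_ops"
  by (simp add: bounded_ops_def Z_apply implementer_scaleC)

lemma bounded_Z: "bounded (Z ` topspace \<tau>)"
proof -
  obtain B where B: "\<And>t x. t \<in> topspace \<tau> \<Longrightarrow> norm (implementer t x) \<le> B * norm x"
    using implementer_bounded by blast
  have "norm (Z t) \<le> max B 0" if t: "t \<in> topspace \<tau>" for t
  proof (rule norm_blinfun_bound)
    show "norm (blinfun_apply (Z t) x) \<le> max B 0 * norm x" for x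
      using B[OF t, of x] mult_right_mono[of B "max B 0" "norm x"] by (simp add: Z_apply[OF t])
  qed simp
  then show ?thesis
    by (auto simp: bounded_iff)
qed

lemma sup_norm_Z: "sup_norm \<tau> Z \<le> map_norm \<tau> D"
proof (cases "map_norm \<tau> D")
  \<comment> \<open>An infinite \<open>map_norm\<close> makes the bound trivial; only a finite value
    \<open>m\<close> needs an argument.\<close>
  case (real m)
  have "norm (Z t) \<le> m" if t: "t \<in> topspace \<tau>" for t
  proof (rule norm_blinfun_bound[OF real(1)])
    show "norm (blinfun_apply (Z t) x) \<le> m * norm x" for x
      unfolding Z_apply[OF t] using implementer_le_map_norm[OF t] real
      by (intro implementer_bound_scale[OF t]) simp
  qed
  then show ?thesis
    unfolding sup_norm_def real(2) by (intro SUP_least ennreal_leI)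
qed simp

lemma commutator_Z:
  assumes X: "X \<in> C0 \<tau>"
  shows "D X = commutator Z X"
proof
  fix t
  show "D X t = commutator Z X t"
  proof (cases "t \<in> topspace \<tau>")
    case True
    then show ?thesis
      by (intro blinfun_eqI)
        (simp add: commutator_def D_eq_deriv_at[OF X] deriv_at_apply C0_compact[OF X] blinfun.diff_left Z_apply)
  next
    case False
    then show ?thesis
      using C0_fun_outside[of X \<tau> t] C0_fun_outside[of "D X" \<tau> t] X D_in[OF X]
      by (simp add: commutator_def C0_eq)
  qed
qed

text \<open>Near \<open>t\<close>, \<open>D X s\<close> is \<open>bump t s\<close> times the fibre
  derivative of the fixed operator \<open>rank_one x \<xi>\<close>. Dividing by the bump expresses
  \<open>Z s x\<close> through continuous functions.\<close>

lemma continuous_map_Z: "continuous_map \<tau> euclidean (\<lambda>t. blinfun_apply (Z t) x)"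
  unfolding continuous_map_atin limitin_canonical_iff
proof
  fix t assume t: "t \<in> topspace \<tau>"
  define X where "X = (\<lambda>s. bump t s *\<^sub>R rank_one x \<xi>)"
  have X: "X \<in> C0 \<tau>"
    unfolding X_def by (intro C0_scaleR_const bump t rank_one_compact)
  have b: "(bump t \<longlongrightarrow> 1) (atin \<tau> t)"
    using C0_fun_tendsto[OF bump(1)[OF t] t] bump(2)[OF t] by simp
  have "(D X \<longlongrightarrow> D X t) (atin \<tau> t)"
    using D_in[OF X] t by (intro C0_fun_tendsto) (simp add: C0_eq)
  then have "((\<lambda>s. inverse (bump t s) *\<^sub>R blinfun_apply (D X s) \<xi>) \<longlongrightarrow>
      inverse 1 *\<^sub>R blinfun_apply (D X t) \<xi>) (atin \<tau> t)"
    by (intro tendsto_intros b) simp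
  moreover have "blinfun_apply (D X t) \<xi> = blinfun_apply (Z t) x"
    by (simp add: Z_apply[OF t] implementer_def deriv_at_def X_def)
  moreover have "\<forall>\<^sub>F s in atin \<tau> t. bump t s \<noteq> 0"
    using b by (rule tendsto_imp_eventually_ne) simp
  then have "\<forall>\<^sub>F s in atin \<tau> t.
      inverse (bump t s) *\<^sub>R blinfun_apply (D X s) \<xi> = blinfun_apply (Z s) x"
  proof (rule eventually_mono)
    fix s assume s: "bump t s \<noteq> 0"
    \<comment> \<open>A bump is 0 outside the space, so its being nonzero already places
      \<open>s\<close> inside.\<close>
    then have "s \<in> topspace \<tau>"
      using C0_fun_outside[OF bump(1)[OF t]] by blast
    then show "inverse (bump t s) *\<^sub>R blinfun_apply (D X s) \<xi> = blinfun_apply (Z s) x"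
      using s by (simp add: X_def D_scaleR_const bump t rank_one_compact Z_apply implementer_def
          blinfun.scaleR_left)
  qed
  ultimately show "((\<lambda>s. blinfun_apply (Z s) x) \<longlongrightarrow> blinfun_apply (Z t) x) (atin \<tau> t)"
    by (simp add: tendsto_cong)
qed

lemma ultraweak_Z: "continuous_map \<tau> ultraweak Z"
  by (intro ultraweak_continuousI Z_bounded_ops bounded_Z continuous_map_Z)

section \<open>Skew-adjointness for *-derivations\<close>

text \<open>For the projection \<open>p = rank_one \<xi> \<xi>\<close>, the Leibniz rule for
  \<open>p = p p\<close> evaluated at \<open>\<xi>\<close> leaves \<open>p\<close> applied to
  \<open>implementer t \<xi>\<close> equal to 0.\<close>

lemma cinner_implementer_unit:
  assumes t: "t \<in> topspace \<tau>"
  shows "cinner (implementer t \<xi>) \<xi> = 0"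
proof -
  have "rank_one \<xi> \<xi> o\<^sub>L rank_one \<xi> \<xi> = rank_one \<xi> \<xi>"
    by (intro blinfun_eqI) (simp add: rank_one.rep_eq cinner_scaleC_left)
  then have "blinfun_apply (deriv_at t (rank_one \<xi> \<xi>)) \<xi>
      = blinfun_apply ((deriv_at t (rank_one \<xi> \<xi>) o\<^sub>L rank_one \<xi> \<xi>) + (rank_one \<xi> \<xi> o\<^sub>L deriv_at t (rank_one \<xi> \<xi>))) \<xi>"
    using deriv_at_mult[OF t rank_one_compact rank_one_compact, of \<xi> \<xi> \<xi> \<xi>] by simp
  then have "cinner (implementer t \<xi>) \<xi> *\<^sub>C \<xi> = 0"
    by (simp add: blinfun.add_left rank_one.rep_eq implementer_def)
  then have "cmod (cinner (implementer t \<xi>) \<xi>) * norm \<xi> = 0"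
    by (metis norm_scaleC norm_zero)
  then show ?thesis
    by (simp add: unit)
qed

text \<open>Adjunction turns \<open>rank_one x \<xi>\<close> into \<open>rank_one \<xi> x\<close>,
  whose fibre derivative is known from \<open>deriv_at_apply\<close>. The normalisation
  \<open>cinner_implementer_unit\<close> removes the surplus term.\<close>

lemma op_adj_Z:
  assumes star: "\<And>X. X \<in> C0 \<tau> \<Longrightarrow> D (\<lambda>s. op_adj (X s)) = (\<lambda>s. op_adj (D X s))"
    and t: "t \<in> topspace \<tau>"
  shows "op_adj (Z t) = - Z t"
proof (rule op_adj_eqI)
  show "- Z t \<in> bounded_ops"
    using Z_bounded_ops[OF t]
    by (simp add: bounded_ops_def blinfun.minus_left scaleC_minus_right)
  fix x w
  have "D (\<lambda>s. op_adj (bump t s *\<^sub>R rank_one x \<xi>)) t = op_adj (D (\<lambda>s. bump t s *\<^sub>R rank_one x \<xi>) t)"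
    by (rule fun_cong[OF star[OF C0_scaleR_const[OF bump(1)[OF t] rank_one_compact]]])
  then have "op_adj (deriv_at t (rank_one x \<xi>)) = deriv_at t (rank_one \<xi> x)"
    by (simp add: deriv_at_def op_adj_scaleR_rank_one)
  then have "cinner (implementer t x) w = cinner \<xi> (blinfun_apply (deriv_at t (rank_one \<xi> x)) w)"
    using cinner_op_adj[OF compact_opsD(1)[OF deriv_at_compact[OF t rank_one_compact]], of x \<xi> \<xi> w]
    by (simp add: implementer_def)
  also have "\<dots> = cnj (cinner w x) * cinner \<xi> (implementer t \<xi>) - cnj (cinner (implementer t w) x)"
    by (simp add: deriv_at_apply t rank_one_compact rank_one.rep_eq implementer_scaleC cinner_diff_right
        cinner_scaleC_right)
  also have "\<dots> = - cinner x (implementer t w)"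
    using cinner_implementer_unit[OF t] cinner_commute[of \<xi> "implementer t \<xi>"] cinner_commute[of x "implementer t w"]
    by simp
  finally show "cinner (blinfun_apply (Z t) x) w = cinner x (blinfun_apply (- Z t) w)"
    by (simp add: Z_apply[OF t] blinfun.minus_left cinner_minus_right)
qed

end

theorem theorem3p6:
  fixes \<tau> :: "'l topology"
    and D :: "('l \<Rightarrow> ('h::complex_hilbert \<Rightarrow>\<^sub>L 'h)) \<Rightarrow> ('l \<Rightarrow> ('h \<Rightarrow>\<^sub>L 'h))"
  assumes "locally_compact_space \<tau>" and "Hausdorff_space \<tau>"
  shows "(star_derivation \<tau> D \<longrightarrow>
            (\<exists>Z\<^sub>0 :: 'l \<Rightarrow> ('h \<Rightarrow>\<^sub>L 'h).
               continuous_map \<tau> ultraweak Z\<^sub>0 \<and>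
               bounded (Z\<^sub>0 ` topspace \<tau>) \<and>
               sup_norm \<tau> Z\<^sub>0 \<le> map_norm \<tau> D \<and>
               (\<forall>t \<in> topspace \<tau>. op_adj (Z\<^sub>0 t) = - Z\<^sub>0 t) \<and>
               (\<forall>X \<in> C0 \<tau>. D X = commutator Z\<^sub>0 X))) \<and>
         (derivation \<tau> D \<longrightarrow>
            (\<exists>Z\<^sub>0 :: 'l \<Rightarrow> ('h \<Rightarrow>\<^sub>L 'h).
               continuous_map \<tau> ultraweak Z\<^sub>0 \<and>
               bounded (Z\<^sub>0 ` topspace \<tau>) \<and>
               sup_norm \<tau> Z\<^sub>0 \<le> 2 * map_norm \<tau> D \<and>
               (\<forall>X \<in> C0 \<tau>. D X = commutator Z\<^sub>0 X)))"
proof -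
  \<comment> \<open>One function serves both claims: the bound with constant 1 holds for every
    derivation, and the skew-adjointness is conditional on \<open>D\<close> respecting
    adjoints.\<close>
  have main: "\<exists>Z\<^sub>0. continuous_map \<tau> ultraweak Z\<^sub>0 \<and> bounded (Z\<^sub>0 ` topspace \<tau>) \<and>
      sup_norm \<tau> Z\<^sub>0 \<le> map_norm \<tau> D \<and>
      (star_derivation \<tau> D \<longrightarrow> (\<forall>t \<in> topspace \<tau>. op_adj (Z\<^sub>0 t) = - Z\<^sub>0 t)) \<and>
      (\<forall>X \<in> C0 \<tau>. D X = commutator Z\<^sub>0 X)" if der: "derivation \<tau> D"
  proof (cases "\<exists>\<xi>::'h. \<xi> \<noteq> 0")
    case True
    then obtain \<xi> :: 'h where "\<xi> \<noteq> 0" by blast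
    then interpret C0_derivation \<tau> D "inverse (norm \<xi>) *\<^sub>R \<xi>"
      by unfold_locales (use assms der in simp_all)
    show ?thesis
      using ultraweak_Z bounded_Z sup_norm_Z op_adj_Z commutator_Z
      by (intro exI[of _ Z]) (auto simp: star_derivation_def)
  next
    case False
    \<comment> \<open>On the zero Hilbert space all operators coincide, so the zero function
      satisfies every equation.\<close>
    then have eq: "S = T" for S T :: "'h \<Rightarrow>\<^sub>L 'h"
      by (intro blinfun_eqI) (metis (full_types))
    have "continuous_map \<tau> ultraweak (\<lambda>_. 0 :: 'h \<Rightarrow>\<^sub>L 'h)"
    proof (rule ultraweak_continuousI)
      show "(0 :: 'h \<Rightarrow>\<^sub>L 'h) \<in> bounded_ops"
        using compact_opsD(1)[OF rank_one_compact] eq by metis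
      show "bounded ((\<lambda>_. 0 :: 'h \<Rightarrow>\<^sub>L 'h) ` topspace \<tau>)"
        by (rule bounded_subset[of "{0}"]) auto
    qed simp
    moreover have "sup_norm \<tau> (\<lambda>_. 0 :: 'h \<Rightarrow>\<^sub>L 'h) \<le> map_norm \<tau> D"
      unfolding sup_norm_def by (rule SUP_least) simp
    moreover have "bounded ((\<lambda>_. 0 :: 'h \<Rightarrow>\<^sub>L 'h) ` topspace \<tau>)"
      by (rule bounded_subset[of "{0}"]) auto
    ultimately show ?thesis
      using eq by (intro exI[of _ "\<lambda>_. 0"]) blast
  qed
  \<comment> \<open>Weakens constant 1 to the stated constant 2; it holds for infinite
    \<open>m\<close> as well.\<close>
  have "m \<le> 2 * m" for m :: ennreal
    by (simp add: mult_2)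
  then show ?thesis
    using main unfolding star_derivation_def by (meson order_trans)
qed

end
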